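(* Let $0<p<1$, $n\ge2$, let $X_1,\dots,X_n$ be i.i.d. with density $f_p(x)=px^{p-1}$ on $(0,1]$, $Q=\sum_{i=1}^n(X_i-\overline X)^2$ with cdf $F_Q$, and $\delta=\min(np,n-1)/2$. Define for $y\ge0$ $$h_p^\pm(y)=p\int_0^\infty e^{-(x\pm y)^2}x^{p-1}\,dx=2^{-p/2}\Gamma(p+1)e^{-y^2/2}U\big(p-\tfrac12,\pm y\sqrt2\big),$$ where $U$ is the parabolic cylinder function. Then, as $x\to0^+$, $$F_Q(x)\sim C_{pn}x^{\delta}\ \ (np\ne n-1),\qquad F_Q(x)\sim C_{pn}x^{(n-1)/2}\ln(1/x)\ \ (np=n-1),$$ where the constants $C_{pn}$ are given by $\Gamma(1+\delta)\sqrt{\pi/n}\,C_{pn}$ being equal to $\int_0^\infty\big((h_p^-(y))^n+(h_p^+(y))^n\big)dy$ if $np<n-1$, to $(p\sqrt\pi)^n/((p-1)n+1)$ if $np>n-1$, and to $(p\sqrt\pi)^n/2$ if $np=n-1$.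
   Context: $a(x)\sim b(x)$ means $a(x)/b(x)\to1$. *)

theory Defs
  imports "HOL-Probability.Probability" "HOL-Library.Landau_Symbols"
begin

definition fdens :: "real \<Rightarrow> real \<Rightarrow> real" where
  "fdens p x = indicator {0<..1} x * (p * x powr (p - 1))"

definition Xdist :: "real \<Rightarrow> real measure" where
  "Xdist p = density lborel (\<lambda>x. ennreal (fdens p x))"

text \<open>Joint law of i.i.d. X_0,...,X_{n-1}: product measure; X_i are coordinate projections.\<close>
definition Xjoint :: "real \<Rightarrow> nat \<Rightarrow> (nat \<Rightarrow> real) measure" where
  "Xjoint p n = PiM {..<n} (\<lambda>_. Xdist p)"

definition Xbar :: "nat \<Rightarrow> (nat \<Rightarrow> real) \<Rightarrow> real" where
  "Xbar n \<omega> = (\<Sum>i<n. \<omega> i) / real n"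

definition Qstat :: "nat \<Rightarrow> (nat \<Rightarrow> real) \<Rightarrow> real" where
  "Qstat n \<omega> = (\<Sum>i<n. (\<omega> i - Xbar n \<omega>)^2)"

definition FQ :: "real \<Rightarrow> nat \<Rightarrow> real \<Rightarrow> real" where
  "FQ p n x = measure (Xjoint p n) {\<omega> \<in> space (Xjoint p n). Qstat n \<omega> \<le> x}"

definition delta :: "real \<Rightarrow> nat \<Rightarrow> real" where
  "delta p n = min (real n * p) (real n - 1) / 2"

definition hminus :: "real \<Rightarrow> real \<Rightarrow> real" where
  "hminus p y = p * (LBINT x:{0<..}. (exp (- ((x - y)^2)) * x powr (p - 1)))"

definition hplus :: "real \<Rightarrow> real \<Rightarrow> real" where
  "hplus p y = p * (LBINT x:{0<..}. (exp (- ((x + y)^2)) * x powr (p - 1)))"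

definition Cpn :: "real \<Rightarrow> nat \<Rightarrow> real" where
  "Cpn p n = (if real n * p < real n - 1
     then (LBINT y:{0..}. ((hminus p y)^n + (hplus p y)^n))
     else if real n * p > real n - 1
     then (p * sqrt pi)^n / ((p - 1) * real n + 1)
     else (p * sqrt pi)^n / 2) / (Gamma (1 + delta p n) * sqrt (pi / real n))"

end

theory Submission
  imports Defs "HOL-Real_Asymp.Real_Asymp"
begin

text \<open>
  Completing the square, \<open>exp (- T\<^sup>2 Q)\<close> is \<open>sqrt (n / \<pi>)\<close> times the integral over \<open>y\<close> of
  \<open>\<Prod>i. exp (- (T X\<^sub>i - y)\<^sup>2)\<close>. By independence and scaling, the Laplace transform of \<open>Q\<close> at
  \<open>T\<^sup>2\<close> is therefore \<open>sqrt (n / \<pi>) T\<^bsup>-np\<^esup>\<close> times the integral over \<open>y\<close> of the \<open>n\<close>-th power of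
  \<open>h\<^sub>T(y) = p \<integral>\<^sub>0\<^sup>T exp (- (x - y)\<^sup>2) x\<^bsup>p-1\<^esup> dx\<close>. Now \<open>h\<^sub>T\<close> increases to \<open>h\<^sub>p\<^sup>-\<close> (extended to negative
  \<open>y\<close> by \<open>h\<^sub>p\<^sup>+\<close>), which decays like \<open>p sqrt \<pi> y\<^bsup>p-1\<^esup>\<close>. If \<open>n(1 - p) > 1\<close> the integral converges
  to the one in the theorem; otherwise it diverges like \<open>(p sqrt \<pi>)\<^sup>n \<integral>\<^sub>1\<^sup>T y\<^bsup>n(p-1)\<^esup> dy\<close>, since the part
  with \<open>y < 0\<close> or \<open>y > T\<close> stays bounded. Karamata's Tauberian theorem transfers the asymptotics to
  the distribution function.
\<close>

section \<open>A Tauberian theorem\<close>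

lemma has_bochner_integral_powr_Ioc:
  fixes q c :: real
  assumes "0 < q" "0 \<le> c"
  shows "has_bochner_integral lborel (\<lambda>x. indicator {0<..c} x * (q * x powr (q - 1))) (c powr q)"
proof (rule has_bochner_integral_nn_integral)
  have "((\<lambda>x. q * x powr (q - 1)) has_integral q * (c powr q / q)) {0..c}"
    using has_integral_powr_from_0[of "q - 1" c] assms by (intro has_integral_mult_right) auto
  then have "(\<integral>\<^sup>+ x. indicator {0..c} x * (q * x powr (q - 1)) \<partial>lborel) = q * (c powr q / q)"
    using assms by (intro nn_integral_has_integral_lebesgue) auto
  \<comment> \<open>\<open>0 powr (q - 1)\<close> is 0 by convention, so closing the interval at 0
    changes nothing even though the density may be singular there.\<close>
  moreover have "(\<integral>\<^sup>+ x. indicator {0<..c} x * (q * x powr (q - 1)) \<partial>lborel)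
      = (\<integral>\<^sup>+ x. indicator {0..c} x * (q * x powr (q - 1)) \<partial>lborel)"
    by (intro nn_integral_cong) (auto simp: indicator_def)
  ultimately show "(\<integral>\<^sup>+ x. indicator {0<..c} x * (q * x powr (q - 1)) \<partial>lborel) = c powr q"
    using assms by simp
qed (use assms in \<open>auto simp: indicator_def\<close>)

text \<open>Euler's integral for Gamma after the substitution \<open>u = c * s\<close>. It is the
  Laplace transform of the measure with distribution function \<open>s powr q\<close>, the limit
  object in Karamata's theorem.\<close>

lemma has_bochner_integral_powr_exp:
  fixes q c :: real
  assumes q: "0 < q" and c: "0 < c"
  shows "has_bochner_integral lborel (\<lambda>s. indicator {0<..} s * (q * s powr (q - 1)) * exp (- (c * s)))
           (Gamma (1 + q) * c powr (- q))"
proof -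
  have 1: "has_bochner_integral lborel (\<lambda>s. indicator {0..} s * s powr (q - 1) / exp s) (Gamma q)"
    using Gamma_conv_nn_integral_real[OF q] q
    by (intro has_bochner_integral_nn_integral) (auto simp: Gamma_real_nonneg)
  have "has_bochner_integral lborel (\<lambda>s. q * (indicator {0..} (0 + c * s) * (0 + c * s) powr (q - 1) / exp (0 + c * s)))
          (q * (Gamma q /\<^sub>R \<bar>c\<bar>))"
    using 1 c by (intro has_bochner_integral_mult_right)
      (subst lborel_has_bochner_integral_real_affine_iff[of c _ _ 0, symmetric], auto)
  \<comment> \<open>The factor \<open>c powr (1 - q)\<close> undoes the
    \<open>c powr (q - 1)\<close> that comes out of \<open>(c * s) powr (q - 1)\<close>.\<close>
  then have "has_bochner_integral lborel
      (\<lambda>s. c powr (1 - q) * (q * (indicator {0..} (0 + c * s) * (0 + c * s) powr (q - 1) / exp (0 + c * s))))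
      (c powr (1 - q) * (q * (Gamma q /\<^sub>R \<bar>c\<bar>)))"
    by (rule has_bochner_integral_mult_right)
  moreover have "c powr (1 - q) * (q * (indicator {0..} (0 + c * s) * (0 + c * s) powr (q - 1) / exp (0 + c * s)))
      = indicator {0<..} s * (q * s powr (q - 1)) * exp (- (c * s))" for s
  proof -
    have "c powr (1 - q) * c powr (q - 1) = 1"
      using c by (simp flip: powr_add)
    then show ?thesis
      using c by (auto simp: indicator_def powr_mult exp_minus field_simps zero_le_mult_iff)
  qed
  moreover have "c powr (1 - q) * (q * (Gamma q /\<^sub>R \<bar>c\<bar>)) = Gamma (1 + q) * c powr (- q)"
  proof -
    have "q \<notin> \<int>\<^sub>\<le>\<^sub>0" using q by (auto elim!: nonpos_Ints_cases)
    then have "Gamma (1 + q) = q * Gamma q" using Gamma_plus1[of q] by (simp add: add.commute)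
    then show ?thesis using c by (simp add: powr_diff powr_minus field_simps)
  qed
  ultimately show ?thesis by simp
qed

text \<open>Three-term epsilon argument: \<open>f\<close> stays near \<open>g\<close>,
  \<open>g\<close> near its limit \<open>m\<close>, and \<open>m\<close> near \<open>l\<close>. It
  carries limits over from polynomials to continuous functions.\<close>

lemma tendsto_uniform_approx:
  fixes f :: "'a \<Rightarrow> real"
  assumes "\<And>e. e > 0 \<Longrightarrow> \<exists>g m. (g \<longlongrightarrow> m) F \<and> (\<forall>\<^sub>F x in F. \<bar>f x - g x\<bar> \<le> e) \<and> \<bar>l - m\<bar> \<le> e"
  shows "(f \<longlongrightarrow> l) F"
proof (rule tendstoI)
  fix e :: real assume "e > 0"
  then obtain g m where g: "(g \<longlongrightarrow> m) F" "\<forall>\<^sub>F x in F. \<bar>f x - g x\<bar> \<le> e / 4" "\<bar>l - m\<bar> \<le> e / 4"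
    using assms[of "e / 4"] by auto
  have "\<forall>\<^sub>F x in F. dist (g x) m < e / 4"
    using g(1) \<open>e > 0\<close> by (intro tendstoD) auto
  with g(2) show "\<forall>\<^sub>F x in F. dist (f x) l < e"
  proof eventually_elim
    case (elim x)
    then show ?case using g(3) \<open>e > 0\<close> unfolding dist_real_def by linarith
  qed
qed

text \<open>
  Karamata's theorem. The hypothesis at \<open>(k + 1) t\<close> gives the limits of the expectations of the monomials
  \<open>v\<^bsup>k+1\<^esup>\<close> in \<open>v = exp (- t Z)\<close>, Weierstrass approximation extends them to \<open>v r(v)\<close> with \<open>r\<close>
  continuous, and the indicator of \<open>v \<ge> exp (- 1)\<close> is squeezed between such functions.
\<close>

locale karamata = finite_measure M for M :: "'a measure" +
  fixes Z :: "'a \<Rightarrow> real" and L :: "real \<Rightarrow> real" and q A :: real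
  assumes Z[measurable]: "Z \<in> borel_measurable M"
    and Z_nonneg: "\<And>\<omega>. 0 \<le> Z \<omega>"
    and q: "0 < q" and A: "0 \<le> A"
    and L_pos: "\<forall>\<^sub>F t in at_top. 0 < L t"
    and L_slow: "\<And>k::nat. ((\<lambda>t. L (real (Suc k) * t) / L t) \<longlongrightarrow> 1) at_top"
    and laplace: "((\<lambda>t. t powr q / L t * (\<integral>\<omega>. exp (- (t * Z \<omega>)) \<partial>M)) \<longlongrightarrow> A * Gamma (1 + q)) at_top"
begin

abbreviation "W t \<equiv> t powr q / L t"

text \<open>Up to the factor \<open>A\<close>, the density of the limit of the weighted laws of
  \<open>t * Z\<close>; its mass on \<open>{0<..b}\<close> is \<open>b powr q\<close>.\<close>

abbreviation "g s \<equiv> indicator {0<..} s * (q * s powr (q - 1))"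

lemma tendsto_power:
  "((\<lambda>t. W t * (\<integral>\<omega>. exp (- (t * Z \<omega>)) ^ Suc k \<partial>M)) \<longlongrightarrow>
      A * (\<integral>s. g s * exp (- s) ^ Suc k \<partial>lborel)) at_top"
proof -
  define c where "c = real (Suc k)"
  have c: "c > 0" unfolding c_def by simp
  have at: "filterlim (\<lambda>t. c * t) at_top at_top"
    using c by (intro filterlim_tendsto_pos_mult_at_top[OF tendsto_const] filterlim_ident)
  \<comment> \<open>\<open>W (c * t)\<close> becomes \<open>W t\<close> after multiplication by
    \<open>c powr (-q)\<close> and by the ratio \<open>L (c * t) / L t\<close>, which slow variation
    sends to 1.\<close>
  have "((\<lambda>t. (W (c * t) * (\<integral>\<omega>. exp (- (c * t * Z \<omega>)) \<partial>M)) * (L (c * t) / L t) * c powr (-q)) \<longlongrightarrow>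
      (A * Gamma (1 + q)) * 1 * c powr (-q)) at_top"
    by (intro tendsto_mult tendsto_const filterlim_compose[OF laplace at])
       (use L_slow[of k] c_def in auto)
  moreover have "\<forall>\<^sub>F t in at_top. (W (c * t) * (\<integral>\<omega>. exp (- (c * t * Z \<omega>)) \<partial>M)) * (L (c * t) / L t) * c powr (-q)
      = W t * (\<integral>\<omega>. exp (- (t * Z \<omega>)) ^ Suc k \<partial>M)"
    using filterlim_iff[THEN iffD1, OF at, rule_format, OF L_pos] L_pos eventually_gt_at_top[of 0]
  proof eventually_elim
    case (elim t)
    have "exp (- (c * t * Z \<omega>)) = exp (- (t * Z \<omega>)) ^ Suc k" for \<omega>
      unfolding c_def by (simp only: exp_of_nat_mult[symmetric]) (simp add: mult_ac)
    moreover have "(c * t) powr q * c powr (-q) = t powr q"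
      using c elim by (simp add: powr_mult powr_minus field_simps)
    ultimately show ?case
      using elim by (simp add: field_simps)
  qed
  ultimately have "((\<lambda>t. W t * (\<integral>\<omega>. exp (- (t * Z \<omega>)) ^ Suc k \<partial>M)) \<longlongrightarrow>
      (A * Gamma (1 + q)) * 1 * c powr (-q)) at_top"
    by (rule Lim_transform_eventually)
  moreover have "(\<integral>s. g s * exp (- s) ^ Suc k \<partial>lborel) = Gamma (1 + q) * c powr (-q)"
  proof -
    have "exp (- s) ^ Suc k = exp (- (c * s))" for s
      unfolding c_def by (simp only: exp_of_nat_mult[symmetric]) (simp add: mult_ac)
    then show ?thesis
      using has_bochner_integral_powr_exp[OF q c] by (simp add: has_bochner_integral_iff)
  qed
  ultimately show ?thesis by (simp add: mult_ac)
qed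

lemma integrable_M_exp:
  assumes "0 \<le> t" "continuous_on {0..1} r"
  shows "integrable M (\<lambda>\<omega>. exp (- (t * Z \<omega>)) * r (exp (- (t * Z \<omega>))))"
proof -
  obtain B where B: "\<forall>x\<in>{0..1}. \<bar>r x\<bar> \<le> B"
    using compact_imp_bounded[OF compact_continuous_image[OF assms(2) compact_Icc]]
    by (auto simp: bounded_iff)
  \<comment> \<open>\<open>r\<close> is controlled only on \<open>{0..1}\<close>, where
    \<open>exp (- (t * Z \<omega>))\<close> takes its values; setting it to 0 elsewhere gives a
    Borel function with the same integrand.\<close>
  have [measurable]: "(\<lambda>x. indicator {0..1} x *\<^sub>R r x) \<in> borel_measurable borel"
    using borel_measurable_continuous_on_indicator[OF _ assms(2)] by simp
  have in01: "exp (- (t * Z \<omega>)) \<in> {0..1}" for \<omega>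
    using assms(1) Z_nonneg by (auto simp: mult_nonneg_nonneg)
  have "(\<lambda>\<omega>. r (exp (- (t * Z \<omega>)))) = (\<lambda>\<omega>. (\<lambda>x. indicator {0..1} x *\<^sub>R r x) (exp (- (t * Z \<omega>))))"
    using in01 by (auto simp: indicator_def)
  also have "\<dots> \<in> borel_measurable M" by measurable
  finally have [measurable]: "(\<lambda>\<omega>. r (exp (- (t * Z \<omega>)))) \<in> borel_measurable M" .
  show ?thesis
  proof (rule integrable_const_bound[where B = B])
    show "AE \<omega> in M. norm (exp (- (t * Z \<omega>)) * r (exp (- (t * Z \<omega>)))) \<le> B"
    proof (intro AE_I2)
      fix \<omega>
      have "norm (exp (- (t * Z \<omega>)) * r (exp (- (t * Z \<omega>)))) \<le> 1 * B"
        unfolding norm_mult using in01[of \<omega>] bspec[OF B in01[of \<omega>]] by (intro mult_mono) auto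
      then show "norm (exp (- (t * Z \<omega>)) * r (exp (- (t * Z \<omega>)))) \<le> B" by simp
    qed
  qed measurable
qed

text \<open>\<open>g\<close> has infinite total mass and \<open>r\<close> is merely bounded, so the
  factor \<open>exp (- s)\<close> must supply the decay. This is why the test functions have the
  form \<open>v * r v\<close>.\<close>

lemma integrable_g_exp:
  assumes "continuous_on {0..1} r"
  shows "integrable lborel (\<lambda>s. g s * (exp (- s) * r (exp (- s))))"
proof -
  obtain B where B: "\<forall>x\<in>{0..1}. \<bar>r x\<bar> \<le> B"
    using compact_imp_bounded[OF compact_continuous_image[OF assms compact_Icc]]
    by (auto simp: bounded_iff)
  have [measurable]: "(\<lambda>x. indicator {0..1} x *\<^sub>R r x) \<in> borel_measurable borel"
    using borel_measurable_continuous_on_indicator[OF _ assms] by simp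
  have "integrable lborel (\<lambda>s. B * (g s * exp (- (1 * s))))"
    using has_bochner_integral_powr_exp[OF q, of 1] by (auto simp: has_bochner_integral_iff)
  then show ?thesis
  proof (rule Bochner_Integration.integrable_bound)
    have "(\<lambda>s. g s * (exp (- s) * r (exp (- s)))) =
        (\<lambda>s. g s * (exp (- s) * (\<lambda>x. indicator {0..1} x *\<^sub>R r x) (exp (- s))))"
      by (auto simp: indicator_def)
    also have "\<dots> \<in> borel_measurable lborel" by measurable
    finally show "(\<lambda>s. g s * (exp (- s) * r (exp (- s)))) \<in> borel_measurable lborel" .
    show "AE s in lborel. norm (g s * (exp (- s) * r (exp (- s)))) \<le> norm (B * (g s * exp (- (1 * s))))"
    proof (intro AE_I2)
      fix s :: real
      show "norm (g s * (exp (- s) * r (exp (- s)))) \<le> norm (B * (g s * exp (- (1 * s))))"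
      proof (cases "s > 0")
        case True
        then have "\<bar>r (exp (- s))\<bar> \<le> \<bar>B\<bar>"
          using bspec[OF B, of "exp (- s)"] by auto
        then have "norm (g s * exp (- s)) * \<bar>r (exp (- s))\<bar> \<le> norm (g s * exp (- s)) * \<bar>B\<bar>"
          by (intro mult_left_mono) auto
        then show ?thesis by (simp add: abs_mult mult_ac)
      qed auto
    qed
  qed
qed

lemma tendsto_continuous:
  assumes r: "continuous_on {0..1} r"
  shows "((\<lambda>t. W t * (\<integral>\<omega>. exp (- (t * Z \<omega>)) * r (exp (- (t * Z \<omega>))) \<partial>M)) \<longlongrightarrow>
      A * (\<integral>s. g s * (exp (- s) * r (exp (- s))) \<partial>lborel)) at_top"
proof (rule tendsto_uniform_approx)
  fix e :: real assume e: "e > 0"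
  \<comment> \<open>\<open>D\<close> eventually bounds the weighted Laplace transform and also
    bounds its limit; the added 1 makes the first bound strict and \<open>D\<close> positive.
    Approximating \<open>r\<close> within \<open>e / D\<close> then costs at most \<open>e\<close>
    on either side.\<close>
  define D where "D = A * Gamma (1 + q) + 1"
  have D: "D > 0" unfolding D_def using A q Gamma_real_nonneg[of "1 + q"] by (simp add: add_nonneg_pos)
  obtain P where P: "real_polynomial_function P" "\<And>x. x \<in> {0..1} \<Longrightarrow> \<bar>r x - P x\<bar> < e / D"
    using Stone_Weierstrass_real_polynomial_function[OF compact_Icc r, of "e / D"] e D by auto
  then obtain a N where P_eq: "P = (\<lambda>x. \<Sum>i\<le>N. a i * x ^ i)"
    by (auto simp: real_polynomial_function_iff_sum)
  have P_cont: "continuous_on {0..1} P"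
    unfolding P_eq by (intro continuous_intros)
  have pow_cont: "continuous_on {0..1} (\<lambda>x::real. x ^ i)" for i
    by (intro continuous_intros)
  let ?V = "\<lambda>t \<omega>. exp (- (t * Z \<omega>))"
  let ?g = "\<lambda>t. W t * (\<integral>\<omega>. ?V t \<omega> * P (?V t \<omega>) \<partial>M)"
  let ?m = "A * (\<integral>s. g s * (exp (- s) * P (exp (- s))) \<partial>lborel)"
  have Wpos: "\<forall>\<^sub>F t in at_top. 0 \<le> W t"
    using L_pos by eventually_elim auto
  have 1: "(?g \<longlongrightarrow> ?m) at_top"
  proof -
    have "((\<lambda>t. \<Sum>i\<le>N. a i * (W t * (\<integral>\<omega>. ?V t \<omega> ^ Suc i \<partial>M))) \<longlongrightarrow>
        (\<Sum>i\<le>N. a i * (A * (\<integral>s. g s * exp (- s) ^ Suc i \<partial>lborel)))) at_top"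
      by (intro tendsto_sum tendsto_mult tendsto_const tendsto_power)
    moreover have "\<forall>\<^sub>F t in at_top. (\<Sum>i\<le>N. a i * (W t * (\<integral>\<omega>. ?V t \<omega> ^ Suc i \<partial>M))) = ?g t"
      using eventually_ge_at_top[of 0]
    proof eventually_elim
      case (elim t)
      have "(\<integral>\<omega>. ?V t \<omega> * P (?V t \<omega>) \<partial>M) = (\<integral>\<omega>. (\<Sum>i\<le>N. a i * ?V t \<omega> ^ Suc i) \<partial>M)"
        by (simp add: P_eq sum_distrib_left mult_ac)
      also have "\<dots> = (\<Sum>i\<le>N. a i * (\<integral>\<omega>. ?V t \<omega> ^ Suc i \<partial>M))"
        using integrable_M_exp[OF elim pow_cont] by (subst Bochner_Integration.integral_sum) auto
      finally show ?case by (simp add: sum_distrib_left mult_ac)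
    qed
    moreover have "(\<Sum>i\<le>N. a i * (A * (\<integral>s. g s * exp (- s) ^ Suc i \<partial>lborel))) = ?m"
    proof -
      have "(\<integral>s. g s * (exp (- s) * P (exp (- s))) \<partial>lborel)
          = (\<integral>s. (\<Sum>i\<le>N. a i * (g s * (exp (- s) * exp (- s) ^ i))) \<partial>lborel)"
        by (simp add: P_eq sum_distrib_left mult_ac)
      also have "\<dots> = (\<Sum>i\<le>N. a i * (\<integral>s. g s * (exp (- s) * exp (- s) ^ i) \<partial>lborel))"
        using integrable_g_exp[OF pow_cont] by (subst Bochner_Integration.integral_sum) auto
      finally show ?thesis by (simp add: sum_distrib_left mult_ac)
    qed
    ultimately show ?thesis
      using Lim_transform_eventually by fastforce
  qed
  have one: "continuous_on {0..1} (\<lambda>x. 1 :: real)" by simp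
  have ev: "\<forall>\<^sub>F t in at_top. W t * (\<integral>\<omega>. ?V t \<omega> \<partial>M) < D"
    using laplace by (rule order_tendstoD) (simp add: D_def)
  have 2: "\<forall>\<^sub>F t in at_top. \<bar>W t * (\<integral>\<omega>. ?V t \<omega> * r (?V t \<omega>) \<partial>M) - ?g t\<bar> \<le> e"
    using ev Wpos eventually_ge_at_top[of 0]
  proof eventually_elim
    case (elim t)
    note I = integrable_M_exp[OF elim(3) r] integrable_M_exp[OF elim(3) P_cont]
    have "\<bar>(\<integral>\<omega>. ?V t \<omega> * r (?V t \<omega>) \<partial>M) - (\<integral>\<omega>. ?V t \<omega> * P (?V t \<omega>) \<partial>M)\<bar>
        = \<bar>\<integral>\<omega>. ?V t \<omega> * r (?V t \<omega>) - ?V t \<omega> * P (?V t \<omega>) \<partial>M\<bar>"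
      using I by simp
    also have "\<dots> \<le> (\<integral>\<omega>. e / D * ?V t \<omega> \<partial>M)"
    proof (rule order_trans[OF integral_abs_bound integral_mono])
      show "integrable M (\<lambda>\<omega>. \<bar>?V t \<omega> * r (?V t \<omega>) - ?V t \<omega> * P (?V t \<omega>)\<bar>)"
        using I by (intro integrable_abs Bochner_Integration.integrable_diff)
      show "integrable M (\<lambda>\<omega>. e / D * ?V t \<omega>)"
        using integrable_M_exp[OF elim(3) one] by simp
      fix \<omega>
      have "\<bar>r (?V t \<omega>) - P (?V t \<omega>)\<bar> < e / D"
        by (rule P) (use elim Z_nonneg[of \<omega>] in \<open>auto simp: mult_nonneg_nonneg\<close>)
      then have "?V t \<omega> * \<bar>r (?V t \<omega>) - P (?V t \<omega>)\<bar> \<le> ?V t \<omega> * (e / D)"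
        by (intro mult_left_mono) auto
      then show "\<bar>?V t \<omega> * r (?V t \<omega>) - ?V t \<omega> * P (?V t \<omega>)\<bar> \<le> e / D * ?V t \<omega>"
        by (simp add: abs_mult mult_ac flip: right_diff_distrib)
    qed
    finally have "W t * \<bar>(\<integral>\<omega>. ?V t \<omega> * r (?V t \<omega>) \<partial>M) - (\<integral>\<omega>. ?V t \<omega> * P (?V t \<omega>) \<partial>M)\<bar>
        \<le> W t * (e / D * (\<integral>\<omega>. ?V t \<omega> \<partial>M))"
      using elim by (intro mult_left_mono) auto
    also have "\<dots> = e / D * (W t * (\<integral>\<omega>. ?V t \<omega> \<partial>M))" by (simp add: mult_ac)
    also have "\<dots> \<le> e / D * D"
      using elim(1) e D by (intro mult_left_mono) auto
    finally have "W t * \<bar>(\<integral>\<omega>. ?V t \<omega> * r (?V t \<omega>) \<partial>M) - (\<integral>\<omega>. ?V t \<omega> * P (?V t \<omega>) \<partial>M)\<bar> \<le> e"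
      using D by simp
    then show ?case
      unfolding right_diff_distrib[symmetric] abs_mult abs_of_nonneg[OF elim(2)] .
  qed
  have 3: "\<bar>A * (\<integral>s. g s * (exp (- s) * r (exp (- s))) \<partial>lborel) - ?m\<bar> \<le> e"
  proof -
    note I = integrable_g_exp[OF r] integrable_g_exp[OF P_cont]
    have "\<bar>(\<integral>s. g s * (exp (- s) * r (exp (- s))) \<partial>lborel) - (\<integral>s. g s * (exp (- s) * P (exp (- s))) \<partial>lborel)\<bar>
        = \<bar>\<integral>s. g s * (exp (- s) * r (exp (- s))) - g s * (exp (- s) * P (exp (- s))) \<partial>lborel\<bar>"
      using I by simp
    also have "\<dots> \<le> (\<integral>s. e / D * (g s * exp (- (1 * s))) \<partial>lborel)"
    proof (rule order_trans[OF integral_abs_bound integral_mono])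
      show "integrable lborel (\<lambda>s. \<bar>g s * (exp (- s) * r (exp (- s))) - g s * (exp (- s) * P (exp (- s)))\<bar>)"
        using I by (intro integrable_abs Bochner_Integration.integrable_diff)
      show "integrable lborel (\<lambda>s. e / D * (g s * exp (- (1 * s))))"
        using integrable_g_exp[OF one] by simp
      fix s :: real
      show "\<bar>g s * (exp (- s) * r (exp (- s))) - g s * (exp (- s) * P (exp (- s)))\<bar> \<le> e / D * (g s * exp (- (1 * s)))"
      proof (cases "s > 0")
        case True
        have "\<bar>r (exp (- s)) - P (exp (- s))\<bar> < e / D"
          by (rule P) (use True in auto)
        then have "(g s * exp (- s)) * \<bar>r (exp (- s)) - P (exp (- s))\<bar> \<le> (g s * exp (- s)) * (e / D)"
          using q by (intro mult_left_mono) auto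
        moreover have "g s * (exp (- s) * r (exp (- s))) - g s * (exp (- s) * P (exp (- s)))
            = (g s * exp (- s)) * (r (exp (- s)) - P (exp (- s)))"
          by (simp add: algebra_simps)
        moreover have "\<bar>g s * exp (- s)\<bar> = g s * exp (- s)" using q by simp
        ultimately show ?thesis
          by (simp only: abs_mult) (simp add: mult_ac)
      qed simp
    qed
    also have "\<dots> = e / D * (\<integral>s. g s * exp (- (1 * s)) \<partial>lborel)" by simp
    also have "\<dots> = e / D * Gamma (1 + q)"
      using has_bochner_integral_powr_exp[OF q, of 1] by (simp add: has_bochner_integral_iff)
    finally have "A * \<bar>(\<integral>s. g s * (exp (- s) * r (exp (- s))) \<partial>lborel) - (\<integral>s. g s * (exp (- s) * P (exp (- s))) \<partial>lborel)\<bar>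
       \<le> A * (e / D * Gamma (1 + q))"
      using A by (intro mult_left_mono)
    also have "\<dots> = e / D * (A * Gamma (1 + q))" by (simp add: mult_ac)
    also have "\<dots> \<le> e / D * D"
      using e D by (intro mult_left_mono) (auto simp: D_def)
    finally have "A * \<bar>(\<integral>s. g s * (exp (- s) * r (exp (- s))) \<partial>lborel) - (\<integral>s. g s * (exp (- s) * P (exp (- s))) \<partial>lborel)\<bar> \<le> e"
      using D by simp
    then show ?thesis
      unfolding right_diff_distrib[symmetric] abs_mult abs_of_nonneg[OF A] .
  qed
  from 1 2 3 show "\<exists>g m. (g \<longlongrightarrow> m) at_top \<and>
     (\<forall>\<^sub>F t in at_top. \<bar>W t * (\<integral>\<omega>. ?V t \<omega> * r (?V t \<omega>) \<partial>M) - g t\<bar> \<le> e) \<and>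
     \<bar>A * (\<integral>s. (indicator {0<..} s * (q * s powr (q - 1))) * (exp (- s) * r (exp (- s))) \<partial>lborel) - m\<bar> \<le> e"
    by blast
qed

text \<open>One continuous test function lies between the indicators of the thresholds
  \<open>b\<close> and \<open>c\<close>. It serves as an upper bound for the first and as a lower
  bound for the second, so both halves of the squeeze use it.\<close>

lemma interpolated_limit:
  assumes bc: "0 < b" "b < c"
  obtains f l where "(f \<longlongrightarrow> l) at_top" "A * b powr q \<le> l" "l \<le> A * c powr q"
    "\<forall>\<^sub>F t in at_top. W t * measure M {\<omega> \<in> space M. t * Z \<omega> \<le> b} \<le> f t"
    "\<forall>\<^sub>F t in at_top. f t \<le> W t * measure M {\<omega> \<in> space M. t * Z \<omega> \<le> c}"
proof -
  \<comment> \<open>In the variable \<open>v = exp (- s)\<close> the order flips: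
    \<open>s \<le> b\<close> means \<open>v \<ge> \<beta>\<close>, and the larger threshold
    \<open>c\<close> gives the smaller \<open>\<alpha>\<close>.\<close>
  define \<alpha> \<beta> where "\<alpha> = exp (- c)" and "\<beta> = exp (- b)"
  have ab: "0 < \<alpha>" "\<alpha> < \<beta>" using bc by (auto simp: \<alpha>_def \<beta>_def)
  define \<psi> where "\<psi> v = max 0 (min 1 ((v - \<alpha>) / (\<beta> - \<alpha>)))" for v
  \<comment> \<open>\<open>\<psi>\<close> vanishes for \<open>v \<le> \<alpha>\<close>, so the
    denominator \<open>v\<close> may be replaced by \<open>max v \<alpha>\<close>:
    \<open>v * r v = \<psi> v\<close> persists and \<open>r\<close> stays continuous at 0.\<close>
  define r where "r v = \<psi> v / max v \<alpha>" for v
  have r: "continuous_on {0..1} r"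
    unfolding r_def \<psi>_def using ab by (intro continuous_intros) auto
  have vr: "v * r v = \<psi> v" for v
  proof (cases "v \<le> \<alpha>")
    case True
    then have "(v - \<alpha>) / (\<beta> - \<alpha>) \<le> 0" using ab by (intro divide_nonpos_pos) auto
    then show ?thesis by (simp add: r_def \<psi>_def)
  qed (use ab in \<open>simp add: r_def\<close>)
  have psi_le: "\<psi> v \<le> (if \<alpha> \<le> v then 1 else 0)" for v
    using ab by (auto simp: \<psi>_def max_def min_def divide_nonpos_pos)
  have psi_ge: "(if \<beta> \<le> v then 1 else 0) \<le> \<psi> v" for v
    using ab by (auto simp: \<psi>_def)
  let ?V = "\<lambda>t \<omega>. exp (- (t * Z \<omega>))"
  let ?f = "\<lambda>t. W t * (\<integral>\<omega>. \<psi> (?V t \<omega>) \<partial>M)"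
  let ?I = "\<integral>s. g s * \<psi> (exp (- s)) \<partial>lborel"
  have Ig: "integrable lborel (\<lambda>s. g s * \<psi> (exp (- s)))"
    using integrable_g_exp[OF r] by (simp add: vr)
  have lim: "(?f \<longlongrightarrow> A * ?I) at_top"
    using tendsto_continuous[OF r] by (simp add: vr)
  have gb: "has_bochner_integral lborel (\<lambda>x. indicator {0<..d} x * (q * x powr (q - 1))) (d powr q)" if "d > 0" for d
    using q that by (intro has_bochner_integral_powr_Ioc) auto
  have "b powr q \<le> ?I"
  proof -
    have "b powr q = (\<integral>x. indicator {0<..b} x * (q * x powr (q - 1)) \<partial>lborel)"
      using gb[OF bc(1)] by (simp add: has_bochner_integral_iff)
    also have "\<dots> \<le> ?I"
    proof (rule integral_mono[OF _ Ig])
      show "integrable lborel (\<lambda>x. indicator {0<..b} x * (q * x powr (q - 1)))"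
        using gb[OF bc(1)] by (simp add: has_bochner_integral_iff)
      fix x :: real
      have "indicator {0<..b} x \<le> indicator {0<..} x * \<psi> (exp (- x))"
        using psi_ge[of "exp (- x)"] by (auto simp: indicator_def \<beta>_def split: if_splits)
      then have "indicator {0<..b} x * (q * x powr (q - 1)) \<le> (indicator {0<..} x * \<psi> (exp (- x))) * (q * x powr (q - 1))"
        using q by (intro mult_right_mono) auto
      then show "indicator {0<..b} x * (q * x powr (q - 1)) \<le> g x * \<psi> (exp (- x))"
        by (simp add: mult_ac)
    qed
    finally show ?thesis .
  qed
  then have l1: "A * b powr q \<le> A * ?I" using A by (rule mult_left_mono)
  have "?I \<le> c powr q"
  proof -
    have "?I \<le> (\<integral>x. indicator {0<..c} x * (q * x powr (q - 1)) \<partial>lborel)"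
    proof (rule integral_mono[OF Ig])
      show "integrable lborel (\<lambda>x. indicator {0<..c} x * (q * x powr (q - 1)))"
        using gb[of c] bc by (simp add: has_bochner_integral_iff)
      fix x :: real
      have "indicator {0<..} x * \<psi> (exp (- x)) \<le> indicator {0<..c} x"
        using psi_le[of "exp (- x)"] by (auto simp: indicator_def \<alpha>_def split: if_splits)
      then have "(indicator {0<..} x * \<psi> (exp (- x))) * (q * x powr (q - 1)) \<le> indicator {0<..c} x * (q * x powr (q - 1))"
        using q by (intro mult_right_mono) auto
      then show "g x * \<psi> (exp (- x)) \<le> indicator {0<..c} x * (q * x powr (q - 1))"
        by (simp add: mult_ac)
    qed
    also have "\<dots> = c powr q"
      using gb[of c] bc by (simp add: has_bochner_integral_iff)
    finally show ?thesis .
  qed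
  then have l2: "A * ?I \<le> A * c powr q" using A by (rule mult_left_mono)
  have meas: "measure M {\<omega> \<in> space M. t * Z \<omega> \<le> d} = (\<integral>\<omega>. indicator {\<omega> \<in> space M. t * Z \<omega> \<le> d} \<omega> \<partial>M)" for t d
    by (simp add: Int_absorb1 Collect_restrict)
  have ind: "integrable M (indicator {\<omega> \<in> space M. t * Z \<omega> \<le> d} :: 'a \<Rightarrow> real)" for t d
    by (rule integrable_const_bound[where B = 1]) auto
  have e1: "\<forall>\<^sub>F t in at_top. W t * measure M {\<omega> \<in> space M. t * Z \<omega> \<le> b} \<le> ?f t"
    using L_pos eventually_ge_at_top[of 0]
  proof eventually_elim
    case (elim t)
    have "measure M {\<omega> \<in> space M. t * Z \<omega> \<le> b} \<le> (\<integral>\<omega>. \<psi> (?V t \<omega>) \<partial>M)"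
      unfolding meas
    proof (rule integral_mono[OF ind])
      show "integrable M (\<lambda>\<omega>. \<psi> (?V t \<omega>))"
        using integrable_M_exp[OF elim(2) r] by (simp add: vr)
      fix \<omega>
      show "indicator {\<omega> \<in> space M. t * Z \<omega> \<le> b} \<omega> \<le> \<psi> (?V t \<omega>)"
        using psi_ge[of "?V t \<omega>"] by (auto simp: indicator_def \<beta>_def split: if_splits)
    qed
    then show ?case using elim by (intro mult_left_mono) auto
  qed
  have e2: "\<forall>\<^sub>F t in at_top. ?f t \<le> W t * measure M {\<omega> \<in> space M. t * Z \<omega> \<le> c}"
    using L_pos eventually_ge_at_top[of 0]
  proof eventually_elim
    case (elim t)
    have "(\<integral>\<omega>. \<psi> (?V t \<omega>) \<partial>M) \<le> measure M {\<omega> \<in> space M. t * Z \<omega> \<le> c}"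
      unfolding meas
    proof (rule integral_mono[OF _ ind])
      show "integrable M (\<lambda>\<omega>. \<psi> (?V t \<omega>))"
        using integrable_M_exp[OF elim(2) r] by (simp add: vr)
      fix \<omega> assume "\<omega> \<in> space M"
      then show "\<psi> (?V t \<omega>) \<le> indicator {\<omega> \<in> space M. t * Z \<omega> \<le> c} \<omega>"
        using psi_le[of "?V t \<omega>"] by (auto simp: indicator_def \<alpha>_def split: if_splits)
    qed
    then show ?case using elim by (intro mult_left_mono) auto
  qed
  show ?thesis by (rule that[OF lim l1 l2 e1 e2])
qed

text \<open>Thresholds slightly above and slightly below 1 squeeze the measure. Since
  \<open>c powr q\<close> is continuous at \<open>c = 1\<close>, both bounds close up at
  \<open>A\<close>.\<close>

theorem tauberian:
  "((\<lambda>t. W t * measure M {\<omega> \<in> space M. t * Z \<omega> \<le> 1}) \<longlongrightarrow> A) at_top"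
proof (rule order_tendstoI)
  fix a assume a: "A < a"
  have "((\<lambda>c. A * c powr q) \<longlongrightarrow> A * 1 powr q) (at_right 1)"
    by (intro tendsto_intros) auto
  then have "\<forall>\<^sub>F c in at_right 1. A * c powr q < a"
    using a by (intro order_tendstoD) auto
  then have "\<forall>\<^sub>F c in at_right 1. A * c powr q < a \<and> c > 1"
    using eventually_at_right_less by (rule eventually_conj)
  then obtain c where c: "A * c powr q < a" "c > 1"
    using eventually_happens by force
  obtain f l where f: "(f \<longlongrightarrow> l) at_top" "l \<le> A * c powr q"
    "\<forall>\<^sub>F t in at_top. W t * measure M {\<omega> \<in> space M. t * Z \<omega> \<le> 1} \<le> f t"
    by (rule interpolated_limit[OF zero_less_one c(2)])
  have "\<forall>\<^sub>F t in at_top. f t < a"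
    using f(1) le_less_trans[OF f(2) c(1)] by (rule order_tendstoD(2))
  with f(3) show "\<forall>\<^sub>F t in at_top. W t * measure M {\<omega> \<in> space M. t * Z \<omega> \<le> 1} < a"
    by eventually_elim simp
next
  fix a assume a: "a < A"
  have "((\<lambda>b. A * b powr q) \<longlongrightarrow> A * 1 powr q) (at_left 1)"
    by (intro tendsto_intros) auto
  then have "\<forall>\<^sub>F b in at_left 1. a < A * b powr q"
    using a by (intro order_tendstoD) auto
  moreover have "\<forall>\<^sub>F b in at_left (1::real). b \<in> {0<..<1}"
    by (rule eventually_at_left_real) simp
  ultimately have "\<forall>\<^sub>F b in at_left 1. a < A * b powr q \<and> b \<in> {0<..<1}"
    by (rule eventually_conj)
  then obtain b where b: "a < A * b powr q" "0 < b" "b < 1"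
    using eventually_happens by force
  obtain f l where f: "(f \<longlongrightarrow> l) at_top" "A * b powr q \<le> l"
    "\<forall>\<^sub>F t in at_top. f t \<le> W t * measure M {\<omega> \<in> space M. t * Z \<omega> \<le> 1}"
    by (rule interpolated_limit[OF b(2,3)])
  have "\<forall>\<^sub>F t in at_top. a < f t"
    using f(1) less_le_trans[OF b(1) f(2)] by (rule order_tendstoD(1))
  with f(3) show "\<forall>\<^sub>F t in at_top. a < W t * measure M {\<omega> \<in> space M. t * Z \<omega> \<le> 1}"
    by eventually_elim simp
qed

end

section \<open>The truncated kernel integral\<close>

lemma has_bochner_integral_gaussian:
  fixes c m :: real
  assumes "0 < c"
  shows "has_bochner_integral lborel (\<lambda>x. exp (- (c * (x - m)\<^sup>2))) (sqrt (pi / c))"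
proof -
  define \<sigma> where "\<sigma> = sqrt (1 / (2 * c))"
  have s: "\<sigma>\<^sup>2 = 1 / (2 * c)" using assms by (simp add: \<sigma>_def)
  have \<sigma>: "\<sigma> > 0" using assms by (simp add: \<sigma>_def)
  have "has_bochner_integral lborel (\<lambda>x. sqrt (pi / c) * normal_density m \<sigma> x) (sqrt (pi / c) * 1)"
    using \<sigma> by (intro has_bochner_integral_mult_right) (simp add: has_bochner_integral_iff)
  moreover have "sqrt (pi / c) * normal_density m \<sigma> x = exp (- (c * (x - m)\<^sup>2))" for x
    unfolding normal_density_def s using assms by (simp add: field_simps)
  ultimately show ?thesis by simp
qed

lemma gaussian_integrable: "integrable lborel (\<lambda>x. exp (- (x - m)\<^sup>2) :: real)"
  and gaussian_integral: "(\<integral>x. exp (- (x - m)\<^sup>2) \<partial>lborel) = sqrt pi" for m :: real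
  using has_bochner_integral_gaussian[of 1 m] by (simp_all add: has_bochner_integral_iff)

lemma gaussian_Icc_integrable: "integrable lborel (\<lambda>w. indicator {-M..M} w * exp (- w\<^sup>2) :: real)"
  using integrable_mult_indicator[OF _ gaussian_integrable[of 0], of "{-M..M}"] by simp

text \<open>The stand-in for \<open>sqrt pi\<close> in lower bounds, where only a window of
  half-width \<open>M\<close> around \<open>y\<close> is used.\<close>

abbreviation gaussian_Icc :: "real \<Rightarrow> real" where
  "gaussian_Icc M \<equiv> \<integral>w. indicator {-M..M} w * exp (- w\<^sup>2) \<partial>lborel"

lemma gaussian_Icc_nonneg: "0 \<le> gaussian_Icc M"
  by (intro integral_nonneg_AE AE_I2) simp

lemma gaussian_Icc_tendsto: "(gaussian_Icc \<longlongrightarrow> sqrt pi) at_top"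
proof -
  have "(gaussian_Icc \<longlongrightarrow> (\<integral>w. exp (- (w - 0)\<^sup>2) \<partial>lborel)) at_top"
  proof (rule integral_dominated_convergence_at_top)
    show "integrable lborel (\<lambda>w. exp (- (w - 0)\<^sup>2) :: real)" by (rule gaussian_integrable)
    show "AE w in lborel. ((\<lambda>M. indicator {-M..M} (w::real) * exp (- w\<^sup>2)) \<longlongrightarrow> exp (- (w - 0)\<^sup>2)) at_top"
    proof (intro AE_I2 tendsto_eventually)
      fix w :: real
      show "\<forall>\<^sub>F M in at_top. indicator {-M..M} w * exp (- w\<^sup>2) = exp (- (w - 0)\<^sup>2)"
        using eventually_ge_at_top[of "\<bar>w\<bar>"] by eventually_elim (auto simp: indicator_def)
    qed
    show "\<forall>\<^sub>F M in at_top. AE w in lborel. norm (indicator {-M..M} (w::real) * exp (- w\<^sup>2)) \<le> exp (- (w - 0)\<^sup>2)"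
      by (intro always_eventually allI AE_I2) (auto simp: indicator_def)
  qed measurable
  then show ?thesis by (simp only: gaussian_integral)
qed

text \<open>The power really decays like \<open>exp (- n * x)\<close>; weakening this to
  \<open>exp (- x)\<close> lets one fixed Gaussian dominate for every positive
  \<open>n\<close>.\<close>

lemma gaussian_power_le:
  fixes a c x :: real
  assumes "0 < n" "0 \<le> a" "a \<le> c * exp (- x)" "0 \<le> x" "0 \<le> c"
  shows "a ^ n \<le> c ^ n * exp (- x)"
proof -
  have "a ^ n \<le> c ^ n * exp (- x) ^ n"
    using power_mono[OF assms(3,2), of n] by (simp add: power_mult_distrib)
  also have "exp (- x) ^ n \<le> exp (- x) ^ 1"
    using assms by (intro power_decreasing) auto
  finally show ?thesis using assms(5) by (simp add: mult_left_mono)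
qed

lemma indicator_Icc_integrable: "integrable lborel (indicator {a..b::real} :: real \<Rightarrow> real)"
  by (cases "a \<le> b") (auto intro!: integrable_real_indicator)

lemma powr_diff_one_power:
  fixes y p :: real
  assumes "0 < y"
  shows "(y powr (p - 1)) ^ n = y powr ((p - 1) * real n)"
  using assms by (simp add: powr_powr flip: powr_realpow)

lemma powr_antideriv:
  fixes b y :: real
  assumes "b + 1 \<noteq> 0" "0 < y"
  shows "((\<lambda>y. y powr (b + 1) / (b + 1)) has_real_derivative y powr b) (at y)"
  using assms by (auto intro!: derivative_eq_intros)

section \<open>The kernel, its truncated integral and the moment\<close>

definition kern :: "real \<Rightarrow> real \<Rightarrow> real \<Rightarrow> real" where
  "kern p y x = indicator {0<..} x * (exp (- (x - y)\<^sup>2) * (p * x powr (p - 1)))"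

text \<open>The \<open>h\<close> with index \<open>T\<close> of the overview: a variable in (0,1]
  scaled by \<open>T\<close> lives on (0,T], hence the cut at \<open>T\<close>.\<close>

definition trunc_h :: "real \<Rightarrow> real \<Rightarrow> real \<Rightarrow> real" where
  "trunc_h p T y = (\<integral>x. indicator {..T} x * kern p y x \<partial>lborel)"

text \<open>Up to an explicit power of \<open>T\<close> and a constant, this is the Laplace
  transform of \<open>Q\<close> at \<open>T^2\<close>.\<close>

definition trunc_h_moment :: "real \<Rightarrow> nat \<Rightarrow> real \<Rightarrow> real" where
  "trunc_h_moment p n T = (\<integral>y. trunc_h p T y ^ n \<partial>lborel)"

lemma kern_measurable [measurable]: "(\<lambda>(y, x). kern p y x) \<in> borel_measurable (borel \<Otimes>\<^sub>M borel)"
  unfolding kern_def by measurable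

lemma kern_measurable' [measurable]: "kern p y \<in> borel_measurable borel"
  unfolding kern_def by measurable

lemma hminus_eq: "hminus p y = (\<integral>x. kern p y x \<partial>lborel)"
  unfolding hminus_def set_lebesgue_integral_def kern_def
  by (subst integral_mult_right_zero[symmetric]) (simp add: mult_ac)

text \<open>Reflection in \<open>y\<close> merges the two functions of the theorem into a single
  function on the whole line.\<close>

lemma hplus_eq: "hplus p y = hminus p (- y)"
  by (simp add: hplus_def hminus_def)

lemma hminus_measurable [measurable]: "hminus p \<in> borel_measurable borel"
proof -
  have "(\<lambda>y. \<integral>x. kern p y x \<partial>lborel) \<in> borel_measurable borel"
    by measurable
  then show ?thesis by (simp add: hminus_eq[abs_def])
qed

lemma trunc_h_measurable [measurable]: "trunc_h p T \<in> borel_measurable borel"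
  unfolding trunc_h_def[abs_def] by measurable

text \<open>The 1 is the mass of the density on (0,1], and \<open>sqrt pi\<close> is the full
  Gaussian mass that bounds the rest.\<close>

abbreviation hbound :: real where "hbound \<equiv> 1 + sqrt pi"

section \<open>Pointwise bounds for the kernel integral\<close>

context
  fixes p :: real
  assumes p: "0 < p" "p < 1"
begin

lemma kern_nonneg: "0 \<le> kern p y x"
  unfolding kern_def using p by simp

lemma powr_01_integrable: "integrable lborel (\<lambda>x. indicator {0<..1} x * (p * x powr (p - 1)))"
  and powr_01_integral: "(\<integral>x. indicator {0<..1} x * (p * x powr (p - 1)) \<partial>lborel) = 1"
  using has_bochner_integral_powr_Ioc[of p 1] p by (simp_all add: has_bochner_integral_iff)

text \<open>Below \<open>x = 1\<close> the Gaussian factor is at most 1; above it the factor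
  \<open>p * x powr (p - 1)\<close> is.\<close>

lemma kern_le: "kern p y x \<le> indicator {0<..1} x * (p * x powr (p - 1)) + exp (- (x - y)\<^sup>2)"
proof -
  have e: "exp (- (x - y)\<^sup>2) \<le> 1" by simp
  consider "x \<le> 0" | "0 < x" "x \<le> 1" | "x > 1" by linarith
  then show ?thesis
  proof cases
    case 2
    have "exp (- (x - y)\<^sup>2) * (p * x powr (p - 1)) \<le> 1 * (p * x powr (p - 1))"
      using p e by (intro mult_right_mono) auto
    then show ?thesis using 2 by (simp add: kern_def add_increasing2)
  next
    case 3
    have "x powr (p - 1) \<le> x powr 0"
      using p 3 by (intro powr_mono) auto
    then have "p * x powr (p - 1) \<le> 1 * 1"
      using p 3 by (intro mult_mono) auto
    then have "exp (- (x - y)\<^sup>2) * (p * x powr (p - 1)) \<le> exp (- (x - y)\<^sup>2) * 1"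
      by (intro mult_left_mono) auto
    then show ?thesis using 3 by (simp add: kern_def)
  qed (simp add: kern_def)
qed

lemma kern_integrable: "integrable lborel (kern p y)"
proof (rule Bochner_Integration.integrable_bound)
  show "integrable lborel (\<lambda>x. indicator {0<..1} x * (p * x powr (p - 1)) + exp (- (x - y)\<^sup>2))"
    by (intro Bochner_Integration.integrable_add powr_01_integrable gaussian_integrable)
  show "AE x in lborel. norm (kern p y x) \<le> norm (indicator {0<..1} x * (p * x powr (p - 1)) + exp (- (x - y)\<^sup>2))"
    using kern_le[of y] kern_nonneg[of y] by (auto intro!: AE_I2 order_trans[OF _ abs_ge_self])
qed measurable

lemma trunc_integrable: "integrable lborel (\<lambda>x. indicator {..T} x * kern p y x)"
  using integrable_mult_indicator[OF _ kern_integrable, of "{..T}"] by simp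

lemma hminus_nonneg: "0 \<le> hminus p y"
  unfolding hminus_eq by (intro integral_nonneg_AE AE_I2 kern_nonneg)

lemma trunc_nonneg: "0 \<le> trunc_h p T y"
  unfolding trunc_h_def by (intro integral_nonneg_AE AE_I2 mult_nonneg_nonneg kern_nonneg) simp

lemma trunc_le: "trunc_h p T y \<le> hminus p y"
  unfolding trunc_h_def hminus_eq
  by (intro integral_mono trunc_integrable kern_integrable) (auto simp: indicator_def kern_nonneg)

lemma hminus_le: "hminus p y \<le> hbound"
proof -
  have "hminus p y \<le> (\<integral>x. indicator {0<..1} x * (p * x powr (p - 1)) + exp (- (x - y)\<^sup>2) \<partial>lborel)"
    unfolding hminus_eq
    by (intro integral_mono kern_integrable Bochner_Integration.integrable_add powr_01_integrable
        gaussian_integrable kern_le)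
  also have "\<dots> = hbound"
    by (subst Bochner_Integration.integral_add)
       (simp_all add: powr_01_integrable gaussian_integrable powr_01_integral gaussian_integral)
  finally show ?thesis .
qed

text \<open>For \<open>x > 0\<close> and \<open>y \<le> 0\<close> the cross term
  \<open>- 2 * x * y\<close> is nonnegative, so a factor \<open>exp (- y^2)\<close> splits
  off.\<close>

lemma hminus_le_neg:
  assumes "y \<le> 0"
  shows "hminus p y \<le> hbound * exp (- y\<^sup>2)"
proof -
  have "kern p y x \<le> exp (- y\<^sup>2) * kern p 0 x" for x
  proof (cases "x > 0")
    case True
    have "exp (- (x - y)\<^sup>2) \<le> exp (- y\<^sup>2) * exp (- (x - 0)\<^sup>2)"
      using True assms by (simp add: power2_diff mult_nonneg_nonpos flip: exp_add)
    then have "exp (- (x - y)\<^sup>2) * (p * x powr (p - 1)) \<le> exp (- y\<^sup>2) * exp (- (x - 0)\<^sup>2) * (p * x powr (p - 1))"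
      using p by (intro mult_right_mono) auto
    then show ?thesis using True by (simp add: kern_def mult_ac)
  qed (simp add: kern_def)
  then have "hminus p y \<le> (\<integral>x. exp (- y\<^sup>2) * kern p 0 x \<partial>lborel)"
    unfolding hminus_eq by (intro integral_mono kern_integrable integrable_mult_right)
  also have "\<dots> = exp (- y\<^sup>2) * hminus p 0" by (simp add: hminus_eq)
  also have "\<dots> \<le> exp (- y\<^sup>2) * hbound" by (intro mult_left_mono hminus_le) auto
  finally show ?thesis by (simp add: mult_ac)
qed

text \<open>The same argument centred at \<open>T\<close>: for \<open>x \<le> T \<le> y\<close> the
  cross term \<open>2 * (T - x) * (y - T)\<close> is nonnegative.\<close>

lemma trunc_le_beyond:
  assumes "T \<le> y"
  shows "trunc_h p T y \<le> hbound * exp (- (y - T)\<^sup>2)"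
proof -
  have "indicator {..T} x * kern p y x \<le> exp (- (y - T)\<^sup>2) * kern p T x" for x
  proof (cases "0 < x \<and> x \<le> T")
    case True
    have "(x - y)\<^sup>2 = (x - T)\<^sup>2 + (y - T)\<^sup>2 + 2 * ((T - x) * (y - T))"
      by (simp add: power2_eq_square algebra_simps)
    moreover have "0 \<le> (T - x) * (y - T)" using True assms by simp
    ultimately have "exp (- (x - y)\<^sup>2) \<le> exp (- (y - T)\<^sup>2) * exp (- (x - T)\<^sup>2)"
      by (simp flip: exp_add)
    then have "exp (- (x - y)\<^sup>2) * (p * x powr (p - 1)) \<le> exp (- (y - T)\<^sup>2) * exp (- (x - T)\<^sup>2) * (p * x powr (p - 1))"
      using p by (intro mult_right_mono) auto
    then show ?thesis using True by (simp add: kern_def mult_ac)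
  next
    case False
    then have zero: "indicator {..T} x * kern p y x = 0" by (auto simp: kern_def indicator_def)
    show ?thesis unfolding zero using kern_nonneg[of T x] by simp
  qed
  then have "trunc_h p T y \<le> (\<integral>x. exp (- (y - T)\<^sup>2) * kern p T x \<partial>lborel)"
    unfolding trunc_h_def by (intro integral_mono trunc_integrable integrable_mult_right kern_integrable)
  also have "\<dots> = exp (- (y - T)\<^sup>2) * hminus p T" by (simp add: hminus_eq)
  also have "\<dots> \<le> exp (- (y - T)\<^sup>2) * hbound" by (intro mult_left_mono hminus_le) auto
  finally show ?thesis by (simp add: mult_ac)
qed

text \<open>Keep only \<open>\<bar>x - y\<bar> \<le> M\<close>, a window inside (0,T]. As
  \<open>p < 1\<close>, the power decreases and is smallest at the right end
  \<open>y + M\<close>.\<close>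

lemma trunc_ge:
  assumes M: "0 < M" "M < y" "y + M \<le> T"
  shows "p * (y + M) powr (p - 1) * gaussian_Icc M \<le> trunc_h p T y"
proof -
  let ?f = "\<lambda>w. indicator {-M..M} w * exp (- w\<^sup>2) :: real"
  have hb: "has_bochner_integral lborel (\<lambda>x. ?f (- y + 1 * x)) ((\<integral>w. ?f w \<partial>lborel) /\<^sub>R \<bar>1\<bar>)"
    by (subst lborel_has_bochner_integral_real_affine_iff[symmetric])
       (auto simp: has_bochner_integral_iff gaussian_Icc_integrable)
  have "p * (y + M) powr (p - 1) * (\<integral>w. ?f w \<partial>lborel) = (\<integral>x. p * (y + M) powr (p - 1) * ?f (- y + 1 * x) \<partial>lborel)"
    using hb by (simp add: has_bochner_integral_iff)
  also have "\<dots> \<le> trunc_h p T y"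
    unfolding trunc_h_def
  proof (rule integral_mono)
    show "integrable lborel (\<lambda>x. p * (y + M) powr (p - 1) * ?f (- y + 1 * x))"
      using hb by (intro integrable_mult_right) (simp add: has_bochner_integral_iff)
    fix x :: real
    show "p * (y + M) powr (p - 1) * ?f (- y + 1 * x) \<le> indicator {..T} x * kern p y x"
    proof (cases "- y + x \<in> {-M..M}")
      case True
      then have x: "0 < x" "x \<le> y + M" "x \<le> T" using M by auto
      have "(y + M) powr (p - 1) \<le> x powr (p - 1)"
        using x p by (intro powr_mono2') auto
      then have "p * (y + M) powr (p - 1) * exp (- (- y + x)\<^sup>2) \<le> p * x powr (p - 1) * exp (- (- y + x)\<^sup>2)"
        using p by (intro mult_mono) auto
      moreover have "- y + x = x - y" by simp
      ultimately show ?thesis using x True by (simp add: kern_def mult_ac)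
    qed (auto simp: kern_nonneg indicator_def)
  qed (rule trunc_integrable)
  finally show ?thesis .
qed

text \<open>Cut at \<open>x = (1 - e) * y\<close>. Left of it the Gaussian is at most
  \<open>exp (- (e * y)^2)\<close>; right of it the decreasing power is at most its value at the
  cut.\<close>

lemma hminus_le_split:
  assumes e: "0 < e" "e < 1" and y: "0 < y"
  shows "hminus p y \<le> exp (- (e * y)\<^sup>2) * (y * (1 - e)) powr p + p * (y * (1 - e)) powr (p - 1) * sqrt pi"
proof -
  define c where "c = y * (1 - e)"
  have c: "c > 0" using e y by (simp add: c_def)
  have hb: "has_bochner_integral lborel (\<lambda>x. indicator {0<..c} x * (p * x powr (p - 1))) (c powr p)"
    using p c by (intro has_bochner_integral_powr_Ioc) auto
  then have i: "integrable lborel (\<lambda>x. indicator {0<..c} x * (p * x powr (p - 1)))"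
    by (simp add: has_bochner_integral_iff)
  have "hminus p y \<le> (\<integral>x. exp (- (e * y)\<^sup>2) * (indicator {0<..c} x * (p * x powr (p - 1)))
      + p * c powr (p - 1) * exp (- (x - y)\<^sup>2) \<partial>lborel)"
    unfolding hminus_eq
  proof (rule integral_mono[OF kern_integrable])
    show "integrable lborel (\<lambda>x. exp (- (e * y)\<^sup>2) * (indicator {0<..c} x * (p * x powr (p - 1)))
      + p * c powr (p - 1) * exp (- (x - y)\<^sup>2))"
      by (intro Bochner_Integration.integrable_add integrable_mult_right i gaussian_integrable)
    fix x :: real
    consider "x \<le> 0" | "0 < x" "x \<le> c" | "c < x" "0 < x" using c by linarith
    then show "kern p y x \<le> exp (- (e * y)\<^sup>2) * (indicator {0<..c} x * (p * x powr (p - 1)))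
      + p * c powr (p - 1) * exp (- (x - y)\<^sup>2)"
    proof cases
      case 2
      have "e * y \<le> y - x" using 2 by (simp add: c_def algebra_simps)
      then have "(e * y)\<^sup>2 \<le> (y - x)\<^sup>2" using e y by (intro power_mono) auto
      then have "exp (- (x - y)\<^sup>2) * (p * x powr (p - 1)) \<le> exp (- (e * y)\<^sup>2) * (p * x powr (p - 1))"
        using p by (intro mult_right_mono) (auto simp: power2_commute)
      moreover have "0 \<le> p * c powr (p - 1) * exp (- (x - y)\<^sup>2)" using p by simp
      ultimately show ?thesis using 2 by (simp add: kern_def)
    next
      case 3
      have "x powr (p - 1) \<le> c powr (p - 1)"
        using 3 p c by (intro powr_mono2') auto
      then have "exp (- (x - y)\<^sup>2) * (p * x powr (p - 1)) \<le> exp (- (x - y)\<^sup>2) * (p * c powr (p - 1))"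
        using p by (intro mult_left_mono) auto
      then show ?thesis using 3 by (simp add: kern_def mult_ac)
    qed (use p in \<open>auto simp: kern_def\<close>)
  qed
  also have "\<dots> = exp (- (e * y)\<^sup>2) * c powr p + p * c powr (p - 1) * sqrt pi"
    using hb i by (subst Bochner_Integration.integral_add)
      (simp_all add: gaussian_integrable gaussian_integral has_bochner_integral_iff)
  finally show ?thesis unfolding c_def .
qed

text \<open>The cut yields the constant \<open>p * sqrt pi * (1 - e) powr (p - 1)\<close>, which
  drops below \<open>k\<close> once \<open>e\<close> is small.\<close>

lemma hminus_asymp_le:
  assumes k: "p * sqrt pi < k"
  shows "\<forall>\<^sub>F y in at_top. hminus p y \<le> k * y powr (p - 1)"
proof -
  have "((\<lambda>e. p * sqrt pi * (1 - e) powr (p - 1)) \<longlongrightarrow> p * sqrt pi * (1 - 0) powr (p - 1)) (at_right 0)"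
    by (intro tendsto_intros) auto
  then have "\<forall>\<^sub>F e in at_right 0. p * sqrt pi * (1 - e) powr (p - 1) < k"
    using k by (intro order_tendstoD) auto
  moreover have "\<forall>\<^sub>F e in at_right (0::real). e \<in> {0<..<1}"
    by (rule eventually_at_right_real) simp
  ultimately have "\<forall>\<^sub>F e in at_right 0. p * sqrt pi * (1 - e) powr (p - 1) < k \<and> e \<in> {0<..<1}"
    by (rule eventually_conj)
  then obtain e where e: "p * sqrt pi * (1 - e) powr (p - 1) < k" "0 < e" "e < 1"
    using eventually_happens by force
  \<comment> \<open>This is the split bound divided by \<open>y powr (p - 1)\<close>; the part left
    of the cut leaves \<open>exp (- (e * y)^2) * y\<close>, which vanishes.\<close>
  have "((\<lambda>y. exp (- (e * y)\<^sup>2) * y * (1 - e) powr p + p * sqrt pi * (1 - e) powr (p - 1)) \<longlongrightarrow>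
      0 * (1 - e) powr p + p * sqrt pi * (1 - e) powr (p - 1)) at_top"
  proof (intro tendsto_intros)
    show "((\<lambda>y. exp (- (e * y)\<^sup>2) * y) \<longlongrightarrow> 0) at_top"
      using e by real_asymp
  qed
  then have "\<forall>\<^sub>F y in at_top. exp (- (e * y)\<^sup>2) * y * (1 - e) powr p + p * sqrt pi * (1 - e) powr (p - 1) < k"
    using e by (intro order_tendstoD) auto
  with eventually_gt_at_top[of 0] show ?thesis
  proof eventually_elim
    case (elim y)
    have yp: "y powr p = y * y powr (p - 1)"
      using elim by (simp add: powr_diff)
    have "hminus p y \<le> exp (- (e * y)\<^sup>2) * (y * (1 - e)) powr p + p * (y * (1 - e)) powr (p - 1) * sqrt pi"
      using e elim by (intro hminus_le_split)
    also have "\<dots> = (exp (- (e * y)\<^sup>2) * y * (1 - e) powr p + p * sqrt pi * (1 - e) powr (p - 1)) * y powr (p - 1)"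
      using e elim by (simp add: powr_mult yp distrib_left mult_ac)
    also have "\<dots> \<le> k * y powr (p - 1)"
      using elim by (intro mult_right_mono) auto
    finally show ?case .
  qed
qed

end

section \<open>Growth of its power integral\<close>

context
  fixes p :: real and n :: nat
  assumes p: "0 < p" "p < 1" and n: "0 < n"
begin

text \<open>The regions \<open>y < 0\<close> and \<open>y > T\<close> are covered by Gaussians
  centred at 0 and at \<open>T\<close>, whose mass does not depend on \<open>T\<close>; any growth
  comes from \<open>{0..T}\<close>.\<close>

lemma trunc_power_le:
  "trunc_h p T y ^ n \<le> hbound ^ n * exp (- (y - 0)\<^sup>2) + indicator {0..T} y * trunc_h p T y ^ n
      + hbound ^ n * exp (- (y - T)\<^sup>2)"
proof -
  consider "y < 0" | "0 \<le> y" "y \<le> T" | "T < y" by linarith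
  then show ?thesis
  proof cases
    case 1
    then have "trunc_h p T y ^ n \<le> hbound ^ n * exp (- (y - 0)\<^sup>2)"
      using order_trans[OF trunc_le[OF p] hminus_le_neg[OF p]] trunc_nonneg[OF p]
      by (intro gaussian_power_le[OF n]) auto
    then show ?thesis using 1 by (simp add: add_increasing2)
  next
    case 3
    then have "trunc_h p T y ^ n \<le> hbound ^ n * exp (- (y - T)\<^sup>2)"
      using trunc_le_beyond[OF p] trunc_nonneg[OF p]
      by (intro gaussian_power_le[OF n]) auto
    then show ?thesis using 3 by (simp add: add_increasing)
  qed simp
qed

lemma trunc_power_le_const: "trunc_h p T y ^ n \<le> hbound ^ n"
  using order_trans[OF trunc_le[OF p] hminus_le[OF p]] trunc_nonneg[OF p] by (intro power_mono) auto

lemma trunc_power_integrable: "integrable lborel (\<lambda>y. trunc_h p T y ^ n)"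
proof (rule Bochner_Integration.integrable_bound)
  let ?U = "\<lambda>y. hbound ^ n * exp (- (y - 0)\<^sup>2) + hbound ^ n * indicator {0..T} y + hbound ^ n * exp (- (y - T)\<^sup>2)"
  show "integrable lborel ?U"
    by (intro Bochner_Integration.integrable_add integrable_mult_right gaussian_integrable indicator_Icc_integrable)
  show "AE y in lborel. norm (trunc_h p T y ^ n) \<le> norm (?U y)"
  proof (intro AE_I2)
    fix y
    have "indicator {0..T} y * trunc_h p T y ^ n \<le> hbound ^ n * indicator {0..T} y"
      using trunc_power_le_const by (auto simp: indicator_def)
    then have "trunc_h p T y ^ n \<le> ?U y"
      using trunc_power_le[of T y] by linarith
    then show "norm (trunc_h p T y ^ n) \<le> norm (?U y)"
      using trunc_nonneg[OF p, of T y] by (simp add: order_trans[OF _ abs_ge_self])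
  qed
qed measurable

text \<open>The two Gaussian tails cost \<open>2 * sqrt pi\<close>, the stretch
  \<open>{0..Y}\<close> costs \<open>Y\<close>, and the power bound is integrated over
  \<open>{Y..T}\<close>. Leaving the antiderivative \<open>G\<close> open covers the power and the
  logarithmic regime at once.\<close>

lemma trunc_h_moment_le:
  assumes k: "0 \<le> k" "\<And>y. Y \<le> y \<Longrightarrow> hminus p y \<le> k * y powr (p - 1)"
    and Y: "0 < Y" "Y \<le> T"
    and G: "\<And>y. 0 < y \<Longrightarrow> (G has_real_derivative y powr ((p - 1) * real n)) (at y)"
  shows "trunc_h_moment p n T \<le> hbound ^ n * (2 * sqrt pi + Y) + k ^ n * (G T - G Y)"
proof -
  have hb: "has_bochner_integral lborel (\<lambda>y. y powr ((p - 1) * real n) * indicator {Y..T} y) (G T - G Y)"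
    using Y by (intro has_bochner_integral_FTC_Icc_real G continuous_intros) auto
  then have i: "integrable lborel (\<lambda>y. y powr ((p - 1) * real n) * indicator {Y..T} y)"
    by (simp add: has_bochner_integral_iff)
  let ?U = "\<lambda>y. hbound ^ n * exp (- (y - 0)\<^sup>2) + hbound ^ n * indicator {0..Y} y
      + k ^ n * (y powr ((p - 1) * real n) * indicator {Y..T} y) + hbound ^ n * exp (- (y - T)\<^sup>2)"
  have "trunc_h_moment p n T \<le> (\<integral>y. ?U y \<partial>lborel)"
    unfolding trunc_h_moment_def
  proof (rule integral_mono[OF trunc_power_integrable])
    show "integrable lborel ?U"
      by (intro Bochner_Integration.integrable_add integrable_mult_right gaussian_integrable
          indicator_Icc_integrable i)
    fix y
    have "indicator {0..T} y * trunc_h p T y ^ n \<le>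
        hbound ^ n * indicator {0..Y} y + k ^ n * (y powr ((p - 1) * real n) * indicator {Y..T} y)"
    proof (cases "y \<in> {0..T}")
      case y: True
      show ?thesis
      proof (cases "y < Y")
        case True
        then show ?thesis using y trunc_power_le_const by simp
      next
        case False
        then have "trunc_h p T y ^ n \<le> (k * y powr (p - 1)) ^ n"
          using order_trans[OF trunc_le[OF p] k(2)] trunc_nonneg[OF p] by (intro power_mono) auto
        also have "\<dots> = k ^ n * y powr ((p - 1) * real n)"
          using False Y powr_diff_one_power[of y p n] by (simp add: power_mult_distrib)
        finally show ?thesis using False y by (simp add: add_increasing)
      qed
    qed (use k in auto)
    then show "trunc_h p T y ^ n \<le> ?U y"
      using trunc_power_le[of T y] by linarith
  qed
  also have "\<dots> = hbound ^ n * sqrt pi + hbound ^ n * Y + k ^ n * (G T - G Y) + hbound ^ n * sqrt pi"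
  proof -
    have "has_bochner_integral lborel ?U (hbound ^ n * sqrt pi + hbound ^ n * Y + k ^ n * (G T - G Y) + hbound ^ n * sqrt pi)"
    proof (intro has_bochner_integral_add has_bochner_integral_mult_right hb)
      show "has_bochner_integral lborel (indicator {0..Y}) Y"
        using Y by (simp add: has_bochner_integral_iff indicator_Icc_integrable)
    qed (simp_all only: has_bochner_integral_iff gaussian_integrable gaussian_integral simp_thms)
    then show ?thesis by (rule has_bochner_integral_integral_eq)
  qed
  finally show ?thesis by (simp add: algebra_simps)
qed

text \<open>The window bound is integrated over \<open>{2 * M..T - M}\<close>, where the window fits
  into (0,T]; the shift by \<open>M\<close> moves the endpoints to \<open>3 * M\<close> and
  \<open>T\<close>. Starting at \<open>2 * M\<close> gives the strict \<open>M < y\<close>.\<close>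

lemma trunc_h_moment_ge:
  assumes M: "0 < M" "3 * M \<le> T"
    and G: "\<And>y. 0 < y \<Longrightarrow> (G has_real_derivative y powr ((p - 1) * real n)) (at y)"
  shows "(p * gaussian_Icc M) ^ n * (G T - G (3 * M)) \<le> trunc_h_moment p n T"
proof -
  have "((\<lambda>y. G (y + M)) has_real_derivative (y + M) powr ((p - 1) * real n)) (at y)" if "2 * M \<le> y" for y
    using G[of "y + M"] that M by (simp add: DERIV_shift)
  then have hb: "has_bochner_integral lborel (\<lambda>y. (y + M) powr ((p - 1) * real n) * indicator {2 * M..T - M} y)
      (G ((T - M) + M) - G (2 * M + M))"
    using M by (intro has_bochner_integral_FTC_Icc_real continuous_intros) auto
  have "(p * gaussian_Icc M) ^ n * (G T - G (3 * M)) =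
      (\<integral>y. (p * gaussian_Icc M) ^ n * ((y + M) powr ((p - 1) * real n) * indicator {2 * M..T - M} y) \<partial>lborel)"
    using hb by (simp add: has_bochner_integral_iff)
  also have "\<dots> \<le> trunc_h_moment p n T"
    unfolding trunc_h_moment_def
  proof (rule integral_mono[OF _ trunc_power_integrable])
    show "integrable lborel (\<lambda>y. (p * gaussian_Icc M) ^ n * ((y + M) powr ((p - 1) * real n) * indicator {2 * M..T - M} y))"
      using hb by (intro integrable_mult_right) (simp add: has_bochner_integral_iff)
    fix y
    show "(p * gaussian_Icc M) ^ n * ((y + M) powr ((p - 1) * real n) * indicator {2 * M..T - M} y) \<le> trunc_h p T y ^ n"
    proof (cases "y \<in> {2 * M..T - M}")
      case True
      have "(p * gaussian_Icc M) ^ n * (y + M) powr ((p - 1) * real n) = (p * (y + M) powr (p - 1) * gaussian_Icc M) ^ n"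
        using powr_diff_one_power[of "y + M" p n] True M by (simp add: power_mult_distrib mult_ac)
      also have "\<dots> \<le> trunc_h p T y ^ n"
        using True M p gaussian_Icc_nonneg by (intro power_mono trunc_ge) auto
      finally show ?thesis using True by simp
    qed (use trunc_nonneg[OF p] in simp)
  qed
  finally show ?thesis .
qed

text \<open>After division by \<open>G T\<close>, which tends to infinity, the terms independent of
  \<open>T\<close> disappear from both bounds. Letting \<open>k\<close> decrease to
  \<open>p * sqrt pi\<close> and \<open>M\<close> grow closes the gap.\<close>

lemma trunc_h_moment_asymp:
  assumes G: "\<And>y. 0 < y \<Longrightarrow> (G has_real_derivative y powr ((p - 1) * real n)) (at y)"
    and lim: "filterlim G at_top at_top"
  shows "((\<lambda>T. trunc_h_moment p n T / G T) \<longlongrightarrow> (p * sqrt pi) ^ n) at_top"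
proof -
  have inv: "((\<lambda>T. c / G T) \<longlongrightarrow> 0) at_top" for c
    by (intro tendsto_divide_0[OF tendsto_const] filterlim_at_top_imp_at_infinity lim)
  have Gpos: "\<forall>\<^sub>F T in at_top. 0 < G T"
    using lim by (simp add: filterlim_at_top_dense)
  show ?thesis
  proof (rule order_tendstoI)
    fix a assume a: "(p * sqrt pi) ^ n < a"
    have "\<forall>\<^sub>F k in at_right (p * sqrt pi). k ^ n < a"
      by (intro order_tendstoD(2)[OF _ a] tendsto_intros)
    then have "\<forall>\<^sub>F k in at_right (p * sqrt pi). k ^ n < a \<and> p * sqrt pi < k"
      using eventually_at_right_less by (rule eventually_conj)
    then obtain k where k: "k ^ n < a" "p * sqrt pi < k"
      using eventually_happens by force
    have k0: "0 \<le> k" using k(2) p by (intro order.trans[OF _ less_imp_le[OF k(2)]]) simp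
    obtain Y where Y: "0 < Y" "\<And>y. Y \<le> y \<Longrightarrow> hminus p y \<le> k * y powr (p - 1)"
      using eventually_conj[OF hminus_asymp_le[OF p k(2)] eventually_gt_at_top[of 0]]
      unfolding eventually_at_top_linorder by auto
    define c where "c = hbound ^ n * (2 * sqrt pi + Y) - k ^ n * G Y"
    have "((\<lambda>T. c / G T + k ^ n) \<longlongrightarrow> 0 + k ^ n) at_top"
      by (intro tendsto_add inv tendsto_const)
    then have "\<forall>\<^sub>F T in at_top. c / G T + k ^ n < a"
      using k by (intro order_tendstoD) auto
    with Gpos eventually_ge_at_top[of Y] show "\<forall>\<^sub>F T in at_top. trunc_h_moment p n T / G T < a"
    proof eventually_elim
      case (elim T)
      have "trunc_h_moment p n T \<le> c + k ^ n * G T"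
        using trunc_h_moment_le[OF k0 Y(2,1) elim(2) G] by (simp add: c_def algebra_simps)
      then have "trunc_h_moment p n T / G T \<le> (c + k ^ n * G T) / G T"
        using elim by (intro divide_right_mono) auto
      also have "\<dots> = c / G T + k ^ n"
        using elim by (simp add: field_simps)
      finally show ?case using elim by simp
    qed
  next
    fix a assume a: "a < (p * sqrt pi) ^ n"
    have "((\<lambda>M. (p * gaussian_Icc M) ^ n) \<longlongrightarrow> (p * sqrt pi) ^ n) at_top"
      by (intro tendsto_power tendsto_mult tendsto_const gaussian_Icc_tendsto)
    then have "\<forall>\<^sub>F M in at_top. a < (p * gaussian_Icc M) ^ n \<and> 0 < M"
      using a by (intro eventually_conj order_tendstoD(1) eventually_gt_at_top)
    then obtain M where M: "a < (p * gaussian_Icc M) ^ n" "0 < M"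
      using eventually_happens by force
    define c where "c = (p * gaussian_Icc M) ^ n"
    have "((\<lambda>T. c - c * G (3 * M) / G T) \<longlongrightarrow> c - 0) at_top"
      by (intro tendsto_diff inv tendsto_const)
    then have "\<forall>\<^sub>F T in at_top. a < c - c * G (3 * M) / G T"
      using M by (intro order_tendstoD) (auto simp: c_def)
    with Gpos eventually_ge_at_top[of "3 * M"] show "\<forall>\<^sub>F T in at_top. a < trunc_h_moment p n T / G T"
    proof eventually_elim
      case (elim T)
      have "c - c * G (3 * M) / G T = c * (G T - G (3 * M)) / G T"
        using elim by (simp add: field_simps)
      also have "\<dots> \<le> trunc_h_moment p n T / G T"
        using elim trunc_h_moment_ge[OF M(2) elim(2) G] by (intro divide_right_mono) (auto simp: c_def)
      finally show ?case using elim by simp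
    qed
  qed
qed

lemma trunc_tendsto: "((\<lambda>T. trunc_h p T y) \<longlongrightarrow> hminus p y) at_top"
  unfolding trunc_h_def hminus_eq
proof (rule integral_dominated_convergence_at_top)
  show "integrable lborel (kern p y)" by (rule kern_integrable[OF p])
  show "AE x in lborel. ((\<lambda>T. indicator {..T} x * kern p y x) \<longlongrightarrow> kern p y x) at_top"
  proof (intro AE_I2 tendsto_eventually)
    fix x :: real
    show "\<forall>\<^sub>F T in at_top. indicator {..T} x * kern p y x = kern p y x"
      using eventually_ge_at_top[of x] by eventually_elim auto
  qed
  show "\<forall>\<^sub>F T in at_top. AE x in lborel. norm (indicator {..T} x * kern p y x) \<le> kern p y x"
    by (intro always_eventually allI AE_I2) (auto simp: indicator_def kern_nonneg[OF p])
qed measurable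

section \<open>The convergent regime, \<open>n * p < n - 1\<close>\<close>

context
  assumes sub: "(p - 1) * real n < - 1"
begin

text \<open>A Gaussian dominates for \<open>y < 0\<close>, a constant on a bounded stretch, and the
  power \<open>y powr ((p - 1) * n)\<close> beyond, which is integrable at infinity as its exponent
  is below -1.\<close>

lemma hminus_power_integrable: "integrable lborel (\<lambda>y. hminus p y ^ n)"
proof -
  \<comment> \<open>Domination needs no sharp constant: any \<open>k\<close> above
    \<open>p * sqrt pi\<close> works.\<close>
  define k where "k = p * sqrt pi + 1"
  have k: "0 \<le> k" "p * sqrt pi < k" using p by (auto simp: k_def add_nonneg_nonneg)
  obtain Y where Y: "0 < Y" "\<And>y. Y \<le> y \<Longrightarrow> hminus p y \<le> k * y powr (p - 1)"
    using eventually_conj[OF hminus_asymp_le[OF p k(2)] eventually_gt_at_top[of 0]]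
    unfolding eventually_at_top_linorder by auto
  have i: "integrable lborel (\<lambda>y. y powr ((p - 1) * real n) * indicator {Y..} y)"
  proof -
    let ?F = "\<lambda>y. y powr ((p - 1) * real n + 1) / ((p - 1) * real n + 1)"
    have "(\<integral>\<^sup>+y. ennreal (y powr ((p - 1) * real n)) * indicator {Y..} y \<partial>lborel) = ennreal (0 - ?F Y)"
    proof (rule nn_integral_FTC_atLeast)
      have "((\<lambda>y. y powr ((p - 1) * real n + 1)) \<longlongrightarrow> 0) at_top"
        using sub by (intro tendsto_neg_powr filterlim_ident) auto
      from tendsto_mult_left_zero[OF this, of "inverse ((p - 1) * real n + 1)"]
      show "(?F \<longlongrightarrow> 0) at_top"
        by (simp add: divide_inverse)
      show "(?F has_real_derivative y powr ((p - 1) * real n)) (at y)" if "Y \<le> y" for y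
        using that sub Y by (intro powr_antideriv) auto
    qed auto
    moreover have "0 \<le> 0 - ?F Y" using sub by (simp add: divide_nonneg_neg)
    ultimately have "has_bochner_integral lborel (\<lambda>y. y powr ((p - 1) * real n) * indicator {Y..} y) (0 - ?F Y)"
      by (intro has_bochner_integral_nn_integral) (auto simp: ennreal_mult' ennreal_indicator)
    then show ?thesis by (simp add: has_bochner_integral_iff)
  qed
  let ?U = "\<lambda>y. hbound ^ n * exp (- (y - 0)\<^sup>2) + hbound ^ n * indicator {0..Y} y
      + k ^ n * (y powr ((p - 1) * real n) * indicator {Y..} y)"
  show ?thesis
  proof (rule Bochner_Integration.integrable_bound)
    show "integrable lborel ?U"
      by (intro Bochner_Integration.integrable_add integrable_mult_right gaussian_integrable
          indicator_Icc_integrable i)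
    show "AE y in lborel. norm (hminus p y ^ n) \<le> norm (?U y)"
    proof (intro AE_I2)
      fix y
      have nn: "0 \<le> k ^ n * (y powr ((p - 1) * real n) * indicator {Y..} y)"
        "0 \<le> hbound ^ n * exp (- (y - 0)\<^sup>2)" "0 \<le> hbound ^ n * indicator {0..Y} y"
        using k by auto
      consider "y < 0" | "0 \<le> y" "y < Y" | "Y \<le> y" by linarith
      then have "hminus p y ^ n \<le> ?U y"
      proof cases
        case 1
        then have "hminus p y ^ n \<le> hbound ^ n * exp (- (y - 0)\<^sup>2)"
          using hminus_le_neg[OF p] hminus_nonneg[OF p] by (intro gaussian_power_le[OF n]) auto
        then show ?thesis using nn by linarith
      next
        case 2
        have "hminus p y ^ n \<le> hbound ^ n"
          using hminus_le[OF p] hminus_nonneg[OF p] by (intro power_mono) auto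
        also have "\<dots> = hbound ^ n * indicator {0..Y} y" using 2 by simp
        finally show ?thesis using nn by linarith
      next
        case 3
        then have "hminus p y ^ n \<le> (k * y powr (p - 1)) ^ n"
          using Y hminus_nonneg[OF p] by (intro power_mono) auto
        also have "\<dots> = k ^ n * (y powr ((p - 1) * real n) * indicator {Y..} y)"
          using 3 Y powr_diff_one_power[of y p n] by (simp add: power_mult_distrib)
        finally show ?thesis using nn by linarith
      qed
      then show "norm (hminus p y ^ n) \<le> norm (?U y)"
        using hminus_nonneg[OF p, of y] by (simp add: order_trans[OF _ abs_ge_self])
    qed
  qed measurable
qed

lemma trunc_h_moment_tendsto: "(trunc_h_moment p n \<longlongrightarrow> (\<integral>y. hminus p y ^ n \<partial>lborel)) at_top"
  unfolding trunc_h_moment_def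
proof (rule integral_dominated_convergence_at_top)
  show "integrable lborel (\<lambda>y. hminus p y ^ n)" by (rule hminus_power_integrable)
  show "AE y in lborel. ((\<lambda>T. trunc_h p T y ^ n) \<longlongrightarrow> hminus p y ^ n) at_top"
    by (intro AE_I2 tendsto_power trunc_tendsto)
  show "\<forall>\<^sub>F T in at_top. AE y in lborel. norm (trunc_h p T y ^ n) \<le> hminus p y ^ n"
    using trunc_nonneg[OF p] trunc_le[OF p]
    by (intro always_eventually allI AE_I2) (auto simp: power_mono)
qed measurable

text \<open>The final asymptotic equivalence requires a nonzero constant. Positivity follows from
  the lower bound for the moment at a single finite \<open>T\<close>.\<close>

lemma hminus_power_integral_pos: "0 < (\<integral>y. hminus p y ^ n \<partial>lborel)"
proof -
  let ?G = "\<lambda>y. y powr ((p - 1) * real n + 1) / ((p - 1) * real n + 1)"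
  have "\<forall>\<^sub>F M in at_top. 0 < gaussian_Icc M \<and> 0 < M"
    by (intro eventually_conj order_tendstoD(1)[OF gaussian_Icc_tendsto] eventually_gt_at_top) simp
  then obtain M where M: "0 < gaussian_Icc M" "0 < M"
    using eventually_happens by force
  \<comment> \<open>A decreasing power divided by a negative number makes \<open>?G\<close> strictly
    increasing; \<open>T = 4 * M\<close> lies just past the endpoint \<open>3 * M\<close> of the
    lower bound.\<close>
  have "(4 * M) powr ((p - 1) * real n + 1) < (3 * M) powr ((p - 1) * real n + 1)"
    using sub M by (intro powr_less_mono2_neg) auto
  then have "?G (3 * M) < ?G (4 * M)"
    using sub by (intro divide_strict_right_mono_neg) auto
  then have "0 < (p * gaussian_Icc M) ^ n * (?G (4 * M) - ?G (3 * M))"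
    using p M by (intro mult_pos_pos zero_less_power) auto
  also have "\<dots> \<le> trunc_h_moment p n (4 * M)"
    using M sub by (intro trunc_h_moment_ge powr_antideriv) auto
  also have "\<dots> \<le> (\<integral>y. hminus p y ^ n \<partial>lborel)"
    unfolding trunc_h_moment_def using trunc_nonneg[OF p] trunc_le[OF p]
    by (intro integral_mono trunc_power_integrable hminus_power_integrable power_mono)
  finally show ?thesis .
qed

text \<open>Reflecting \<open>y\<close> turns the \<open>hplus\<close> part into the integral over
  the negative half-line; the doubly counted point 0 is a null set.\<close>

lemma hminus_hplus_power_integral:
  "(LBINT y:{0..}. hminus p y ^ n + hplus p y ^ n) = (\<integral>y. hminus p y ^ n \<partial>lborel)"
proof -
  let ?f = "\<lambda>y. hminus p y ^ n"
  have i: "integrable lborel (\<lambda>y. indicator S y * ?f y)" if "S \<in> sets borel" for S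
    using integrable_mult_indicator[OF _ hminus_power_integrable, of S] that by simp
  have flip: "has_bochner_integral lborel (\<lambda>y. indicator {..0} (0 + (-1) * y) * ?f (0 + (-1) * y))
      ((\<integral>y. indicator {..0} y * ?f y \<partial>lborel) /\<^sub>R \<bar>-1\<bar>)"
    by (subst lborel_has_bochner_integral_real_affine_iff[symmetric]) (auto simp: has_bochner_integral_iff i)
  have flip': "integrable lborel (\<lambda>y. indicator {0..} y * ?f (- y))"
    "(\<integral>y. indicator {0..} y * ?f (- y) \<partial>lborel) = (\<integral>y. indicator {..0} y * ?f y \<partial>lborel)"
    using flip by (simp_all add: has_bochner_integral_iff indicator_def)
  have "(LBINT y:{0..}. ?f y + hplus p y ^ n) = (\<integral>y. indicator {0..} y * ?f y + indicator {0..} y * ?f (- y) \<partial>lborel)"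
    unfolding set_lebesgue_integral_def hplus_eq by (simp add: algebra_simps)
  also have "\<dots> = (\<integral>y. indicator {0..} y * ?f y \<partial>lborel) + (\<integral>y. indicator {..0} y * ?f y \<partial>lborel)"
    using flip' i by (subst Bochner_Integration.integral_add) auto
  also have "\<dots> = (\<integral>y. indicator {0..} y * ?f y + indicator {..0} y * ?f y \<partial>lborel)"
    using i by (subst Bochner_Integration.integral_add) auto
  also have "\<dots> = (\<integral>y. ?f y \<partial>lborel)"
  proof (rule integral_cong_AE)
    show "AE y in lborel. indicator {0..} y * ?f y + indicator {..0} y * ?f y = ?f y"
      using AE_lborel_singleton[of "0::real"] by eventually_elim (auto simp: indicator_def)
  qed measurable
  finally show ?thesis .
qed

end

end

section \<open>The Laplace transform of the quadratic statistic\<close>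

lemma fdens_measurable [measurable]: "fdens p \<in> borel_measurable borel"
  unfolding fdens_def[abs_def] by measurable

lemma sets_Xdist [measurable_cong, simp]: "sets (Xdist p) = sets borel"
  by (simp add: Xdist_def)

lemma Xjoint_component_measurable:
  "i < n \<Longrightarrow> (\<lambda>\<omega>. \<omega> i) \<in> borel_measurable (Xjoint p n)"
  unfolding Xjoint_def by (rule measurable_compose[OF measurable_component_singleton]) auto

lemma Qstat_measurable [measurable]: "Qstat n \<in> borel_measurable (Xjoint p n)"
proof -
  note Xjoint_component_measurable [measurable]
  show ?thesis unfolding Qstat_def[abs_def] Xbar_def by measurable
qed

lemma gaussian_prod_measurable [measurable]:
  "(\<lambda>(\<omega>, y). \<Prod>i<n. ennreal (exp (- (T * \<omega> i - y)\<^sup>2))) \<in> borel_measurable (Xjoint p n \<Otimes>\<^sub>M lborel)"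
proof -
  note Xjoint_component_measurable [measurable]
  show ?thesis by measurable
qed

lemma Qstat_nonneg: "0 \<le> Qstat n \<omega>"
  unfolding Qstat_def by (intro sum_nonneg) simp

text \<open>Expanding around the mean, the cross term is a multiple of the sum of the deviations,
  which is 0.\<close>

lemma sum_square_decomposition:
  assumes "0 < n"
  shows "(\<Sum>i<n. (T * \<omega> i - y)\<^sup>2) = T\<^sup>2 * Qstat n \<omega> + real n * (y - T * Xbar n \<omega>)\<^sup>2"
proof -
  define m where "m = Xbar n \<omega>"
  have m: "(\<Sum>i<n. \<omega> i) = real n * m" using assms by (simp add: m_def Xbar_def)
  have "(\<Sum>i<n. (T * \<omega> i - y)\<^sup>2) = (\<Sum>i<n. T\<^sup>2 * (\<omega> i - m)\<^sup>2 + 2 * T * (T * m - y) * (\<omega> i - m) + (y - T * m)\<^sup>2)"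
    by (intro sum.cong) (auto simp: power2_eq_square algebra_simps)
  also have "\<dots> = T\<^sup>2 * Qstat n \<omega> + 2 * T * (T * m - y) * (\<Sum>i<n. \<omega> i - m) + real n * (y - T * m)\<^sup>2"
    by (simp add: sum.distrib sum_distrib_left Qstat_def m_def)
  also have "(\<Sum>i<n. \<omega> i - m) = 0"
    by (simp add: sum_subtractf m)
  finally show ?thesis by (simp add: m_def)
qed

section \<open>From the Laplace transform to the distribution function\<close>

context
  fixes p :: real and n :: nat
  assumes p: "0 < p" "p < 1" and n: "0 < n"
begin

lemma prob_space_Xdist: "prob_space (Xdist p)"
proof
  have "(\<integral>\<^sup>+x. ennreal (fdens p x) \<partial>lborel) = ennreal (\<integral>x. fdens p x \<partial>lborel)"
    unfolding fdens_def using p by (intro nn_integral_eq_integral powr_01_integrable[OF p]) auto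
  also have "\<dots> = 1" unfolding fdens_def powr_01_integral[OF p] by simp
  finally show "emeasure (Xdist p) (space (Xdist p)) = 1"
    by (simp add: Xdist_def emeasure_density)
qed

lemma prob_space_Xjoint: "prob_space (Xjoint p n)"
  unfolding Xjoint_def by (intro prob_space_PiM prob_space_Xdist)

text \<open>Substituting \<open>u = T * x\<close> carries (0,1] to (0,T]; the Jacobian
  \<open>T\<close> and the factor \<open>T powr (p - 1)\<close> of the density combine to
  \<open>T powr p\<close>.\<close>

lemma nn_integral_Xdist_gaussian:
  assumes T: "0 < T"
  shows "(\<integral>\<^sup>+x. ennreal (exp (- (T * x - y)\<^sup>2)) \<partial>Xdist p) = ennreal (T powr (- p) * trunc_h p T y)"
proof -
  let ?I = "\<integral>\<^sup>+x. ennreal (fdens p x) * ennreal (exp (- (T * x - y)\<^sup>2)) \<partial>lborel"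
  have "ennreal (trunc_h p T y) = (\<integral>\<^sup>+x. ennreal (indicator {..T} x * kern p y x) \<partial>lborel)"
    unfolding trunc_h_def using kern_nonneg[OF p] trunc_integrable[OF p]
    by (intro nn_integral_eq_integral[symmetric]) auto
  also have "\<dots> = ennreal \<bar>T\<bar> * (\<integral>\<^sup>+x. ennreal (indicator {..T} (0 + T * x) * kern p y (0 + T * x)) \<partial>lborel)"
    using T by (intro nn_integral_real_affine) auto
  also have "(\<integral>\<^sup>+x. ennreal (indicator {..T} (0 + T * x) * kern p y (0 + T * x)) \<partial>lborel)
      = (\<integral>\<^sup>+x. ennreal (T powr (p - 1)) * (ennreal (fdens p x) * ennreal (exp (- (T * x - y)\<^sup>2))) \<partial>lborel)"
  proof (rule nn_integral_cong)
    fix x :: real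
    have "indicator {..T} (0 + T * x) * kern p y (0 + T * x) = T powr (p - 1) * (fdens p x * exp (- (T * x - y)\<^sup>2))"
      using T by (auto simp: kern_def fdens_def indicator_def powr_mult zero_less_mult_iff)
    then show "ennreal (indicator {..T} (0 + T * x) * kern p y (0 + T * x))
       = ennreal (T powr (p - 1)) * (ennreal (fdens p x) * ennreal (exp (- (T * x - y)\<^sup>2)))"
      by (simp add: ennreal_mult' ennreal_mult'')
  qed
  also have "\<dots> = ennreal (T powr (p - 1)) * ?I"
    by (intro nn_integral_cmult) measurable
  finally have eq: "ennreal (trunc_h p T y) = ennreal (T powr p) * ?I"
    using T by (simp add: mult.assoc[symmetric] powr_diff flip: ennreal_mult')
  have "ennreal (T powr (- p) * trunc_h p T y) = ennreal (T powr (- p)) * (ennreal (T powr p) * ?I)"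
    by (subst eq[symmetric]) (simp add: ennreal_mult')
  also have "\<dots> = ?I"
    using T by (simp add: mult.assoc[symmetric] powr_minus flip: ennreal_mult')
  also have "\<dots> = (\<integral>\<^sup>+x. ennreal (exp (- (T * x - y)\<^sup>2)) \<partial>Xdist p)"
    unfolding Xdist_def by (subst nn_integral_density) auto
  finally show ?thesis ..
qed

text \<open>The Gaussian product is integrated over \<open>\<omega>\<close> and \<open>y\<close> in
  both orders. Taking \<open>y\<close> first leaves the Laplace transform; taking
  \<open>\<omega>\<close> first factorises by independence.\<close>

lemma laplace_Qstat:
  assumes T: "0 < T"
  shows "(\<integral>\<omega>. exp (- (T\<^sup>2 * Qstat n \<omega>)) \<partial>Xjoint p n) = sqrt (real n / pi) * T powr (- (real n * p)) * trunc_h_moment p n T"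
proof -
  interpret X: prob_space "Xjoint p n" by (rule prob_space_Xjoint)
  interpret X1: prob_space "Xdist p" by (rule prob_space_Xdist)
  interpret PS: product_sigma_finite "\<lambda>_::nat. Xdist p" ..
  interpret F: pair_sigma_finite "Xjoint p n" "lborel :: real measure" ..
  let ?Phi = "\<integral>\<omega>. exp (- (T\<^sup>2 * Qstat n \<omega>)) \<partial>Xjoint p n"
  have int: "integrable (Xjoint p n) (\<lambda>\<omega>. exp (- (T\<^sup>2 * Qstat n \<omega>)))"
    using Qstat_nonneg by (intro X.integrable_const_bound[where B = 1]) auto
  \<comment> \<open>The mean enters only as the centre \<open>T * Xbar n \<omega>\<close> of a
    Gaussian in \<open>y\<close>, so it is integrated out and leaves a constant.\<close>
  have inner: "(\<integral>\<^sup>+y. (\<Prod>i<n. ennreal (exp (- (T * \<omega> i - y)\<^sup>2))) \<partial>lborel)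
      = ennreal (sqrt (pi / real n)) * ennreal (exp (- (T\<^sup>2 * Qstat n \<omega>)))" for \<omega>
  proof -
    have "(\<Prod>i<n. ennreal (exp (- (T * \<omega> i - y)\<^sup>2)))
        = ennreal (exp (- (T\<^sup>2 * Qstat n \<omega>))) * ennreal (exp (- (real n * (y - T * Xbar n \<omega>)\<^sup>2)))" for y
    proof -
      have "(\<Prod>i<n. exp (- (T * \<omega> i - y)\<^sup>2)) = exp (- (\<Sum>i<n. (T * \<omega> i - y)\<^sup>2))"
        by (simp add: exp_sum sum_negf[symmetric])
      also have "\<dots> = exp (- (T\<^sup>2 * Qstat n \<omega>)) * exp (- (real n * (y - T * Xbar n \<omega>)\<^sup>2))"
        unfolding sum_square_decomposition[OF n] by (simp flip: exp_add)
      finally show ?thesis by (simp add: prod_ennreal ennreal_mult')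
    qed
    moreover have "(\<integral>\<^sup>+y. ennreal (exp (- (real n * (y - T * Xbar n \<omega>)\<^sup>2))) \<partial>lborel) = ennreal (sqrt (pi / real n))"
      using has_bochner_integral_gaussian[of "real n" "T * Xbar n \<omega>"] n
      by (subst nn_integral_eq_integral) (auto simp: has_bochner_integral_iff)
    ultimately show ?thesis
      by (simp add: nn_integral_cmult mult.commute)
  qed
  have "ennreal (sqrt (pi / real n) * ?Phi) = ennreal (sqrt (pi / real n)) * (\<integral>\<^sup>+\<omega>. ennreal (exp (- (T\<^sup>2 * Qstat n \<omega>))) \<partial>Xjoint p n)"
    using int by (simp add: nn_integral_eq_integral ennreal_mult')
  also have "\<dots> = (\<integral>\<^sup>+\<omega>. ennreal (sqrt (pi / real n)) * ennreal (exp (- (T\<^sup>2 * Qstat n \<omega>))) \<partial>Xjoint p n)"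
    by (intro nn_integral_cmult[symmetric]) measurable
  also have "\<dots> = (\<integral>\<^sup>+\<omega>. \<integral>\<^sup>+y. (\<Prod>i<n. ennreal (exp (- (T * \<omega> i - y)\<^sup>2))) \<partial>lborel \<partial>Xjoint p n)"
    by (simp only: inner)
  \<comment> \<open>Tonelli: the integrand is nonnegative, so measurability suffices.\<close>
  also have "\<dots> = (\<integral>\<^sup>+y. \<integral>\<^sup>+\<omega>. (\<Prod>i<n. ennreal (exp (- (T * \<omega> i - y)\<^sup>2))) \<partial>Xjoint p n \<partial>lborel)"
    by (rule F.Fubini'[symmetric, OF gaussian_prod_measurable])
  also have "\<dots> = (\<integral>\<^sup>+y. ennreal ((T powr (- p)) ^ n * trunc_h p T y ^ n) \<partial>lborel)"
  proof (rule nn_integral_cong)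
    fix y :: real
    have "(\<integral>\<^sup>+\<omega>. (\<Prod>i<n. ennreal (exp (- (T * \<omega> i - y)\<^sup>2))) \<partial>Xjoint p n)
        = (\<Prod>i<n. \<integral>\<^sup>+x. ennreal (exp (- (T * x - y)\<^sup>2)) \<partial>Xdist p)"
      unfolding Xjoint_def by (rule PS.product_nn_integral_prod) measurable
    also have "\<dots> = ennreal ((T powr (- p) * trunc_h p T y) ^ n)"
      using trunc_nonneg[OF p] by (simp add: nn_integral_Xdist_gaussian[OF T] ennreal_power)
    finally show "(\<integral>\<^sup>+\<omega>. (\<Prod>i<n. ennreal (exp (- (T * \<omega> i - y)\<^sup>2))) \<partial>Xjoint p n)
        = ennreal ((T powr (- p)) ^ n * trunc_h p T y ^ n)"
      by (simp add: power_mult_distrib)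
  qed
  also have "\<dots> = ennreal (\<integral>y. (T powr (- p)) ^ n * trunc_h p T y ^ n \<partial>lborel)"
    using trunc_nonneg[OF p] trunc_power_integrable[OF p n] by (intro nn_integral_eq_integral) auto
  also have "(\<integral>y. (T powr (- p)) ^ n * trunc_h p T y ^ n \<partial>lborel) = T powr (- (real n * p)) * trunc_h_moment p n T"
    using T by (simp add: trunc_h_moment_def powr_powr mult.commute flip: powr_realpow)
  finally have "ennreal (sqrt (pi / real n) * ?Phi) = ennreal (T powr (- (real n * p)) * trunc_h_moment p n T)" .
  moreover have "0 \<le> trunc_h_moment p n T"
    unfolding trunc_h_moment_def using trunc_nonneg[OF p] by (intro integral_nonneg_AE AE_I2) simp
  moreover have "0 \<le> ?Phi" by (intro integral_nonneg_AE AE_I2) simp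
  ultimately have "sqrt (pi / real n) * ?Phi = T powr (- (real n * p)) * trunc_h_moment p n T"
    by (subst (asm) ennreal_inj) auto
  then have "sqrt (real n / pi) * sqrt (pi / real n) * ?Phi = sqrt (real n / pi) * (T powr (- (real n * p)) * trunc_h_moment p n T)"
    by simp
  moreover have "sqrt (real n / pi) * sqrt (pi / real n) = 1"
    using n by (simp flip: real_sqrt_mult)
  ultimately show ?thesis by simp
qed

text \<open>Karamata's theorem with Laplace variable \<open>t = T^2\<close>:
  \<open>T powr (2 * q - n * p)\<close> is \<open>t powr q\<close> times the power of
  \<open>T\<close> in the Laplace transform. The factor \<open>L\<close> leaves room for a
  logarithm.\<close>

lemma FQ_tendsto:
  assumes q: "0 < q" and D: "0 \<le> D"
    and L_pos: "\<forall>\<^sub>F t in at_top. 0 < L t"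
    and L_slow: "\<And>k::nat. ((\<lambda>t. L (real (Suc k) * t) / L t) \<longlongrightarrow> 1) at_top"
    and lim: "((\<lambda>T. T powr (2 * q - real n * p) * trunc_h_moment p n T / L (T\<^sup>2)) \<longlongrightarrow> D) at_top"
  shows "((\<lambda>x. FQ p n x / (x powr q * L (1 / x))) \<longlongrightarrow> D / (Gamma (1 + q) * sqrt (pi / real n))) (at_right 0)"
proof -
  \<comment> \<open>Chosen so that \<open>A * Gamma (1 + q)\<close> equals
    \<open>sqrt (n / pi) * D\<close>, the limit of the weighted Laplace transform.\<close>
  define A where "A = D / (Gamma (1 + q) * sqrt (pi / real n))"
  have Gam: "0 < Gamma (1 + q)" using q by (intro Gamma_real_pos) simp
  interpret X: prob_space "Xjoint p n" by (rule prob_space_Xjoint)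
  interpret karamata "Xjoint p n" "Qstat n" L q A
  proof unfold_locales
    show "0 \<le> A" unfolding A_def using D Gam by simp
    show "((\<lambda>t. t powr q / L t * (\<integral>\<omega>. exp (- (t * Qstat n \<omega>)) \<partial>Xjoint p n)) \<longlongrightarrow> A * Gamma (1 + q)) at_top"
    proof (rule Lim_transform_eventually)
      have "((\<lambda>t. sqrt (real n / pi) * (sqrt t powr (2 * q - real n * p) * trunc_h_moment p n (sqrt t) / L ((sqrt t)\<^sup>2))) \<longlongrightarrow>
          sqrt (real n / pi) * D) at_top"
        by (intro tendsto_mult tendsto_const filterlim_compose[OF lim sqrt_at_top])
      moreover have "sqrt (real n / pi) * D = A * Gamma (1 + q)"
        using Gam n by (simp add: A_def real_sqrt_divide field_simps)
      ultimately show "((\<lambda>t. sqrt (real n / pi) * (sqrt t powr (2 * q - real n * p) * trunc_h_moment p n (sqrt t) / L ((sqrt t)\<^sup>2))) \<longlongrightarrow>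
          A * Gamma (1 + q)) at_top" by simp
      show "\<forall>\<^sub>F t in at_top. sqrt (real n / pi) * (sqrt t powr (2 * q - real n * p) * trunc_h_moment p n (sqrt t) / L ((sqrt t)\<^sup>2))
          = t powr q / L t * (\<integral>\<omega>. exp (- (t * Qstat n \<omega>)) \<partial>Xjoint p n)"
        using eventually_gt_at_top[of 0]
      proof eventually_elim
        case (elim t)
        have "sqrt t powr (2 * q - real n * p) = t powr q * sqrt t powr (- (real n * p))"
        proof -
          have "sqrt t powr (2 * q - real n * p) = sqrt t powr (2 * q) * sqrt t powr (- (real n * p))"
            by (simp flip: powr_add)
          also have "sqrt t powr (2 * q) = t powr q"
            using elim by (simp add: powr_powr flip: powr_half_sqrt)
          finally show ?thesis .
        qed
        then show ?case
          using laplace_Qstat[of "sqrt t"] elim by (simp add: mult_ac)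
      qed
    qed
  qed (use q L_pos L_slow Qstat_nonneg in auto)
  \<comment> \<open>For \<open>t = 1 / x\<close> the event \<open>t * Q \<le> 1\<close> is
    \<open>Q \<le> x\<close>, and \<open>W t\<close> is the reciprocal of
    \<open>x powr q * L (1 / x)\<close>.\<close>
  have "((\<lambda>x. W (1 / x) * measure (Xjoint p n) {\<omega> \<in> space (Xjoint p n). (1 / x) * Qstat n \<omega> \<le> 1}) \<longlongrightarrow> A) (at_right 0)"
    using filterlim_inverse_at_top_right
    by (intro filterlim_compose[OF tauberian]) (simp add: inverse_eq_divide)
  moreover have "\<forall>\<^sub>F x in at_right 0. W (1 / x) * measure (Xjoint p n) {\<omega> \<in> space (Xjoint p n). (1 / x) * Qstat n \<omega> \<le> 1}
      = FQ p n x / (x powr q * L (1 / x))"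
    using eventually_at_right_less[of 0]
  proof eventually_elim
    case (elim x)
    have "(1 / x) * Qstat n \<omega> \<le> 1 \<longleftrightarrow> Qstat n \<omega> \<le> x" for \<omega>
      using elim by (simp add: field_simps)
    then show ?case
      using elim by (simp add: FQ_def powr_divide field_simps)
  qed
  ultimately show ?thesis
    unfolding A_def by (rule Lim_transform_eventually)
qed

end

section \<open>Assembly of the three regimes\<close>

theorem theorem3:
  fixes p :: real and n :: nat
  assumes "0 < p" "p < 1" "n \<ge> 2"
  shows "(real n * p \<noteq> real n - 1 \<longrightarrow>
            FQ p n \<sim>[at_right 0] (\<lambda>x. Cpn p n * x powr delta p n))
       \<and> (real n * p = real n - 1 \<longrightarrow>
            FQ p n \<sim>[at_right 0] (\<lambda>x. Cpn p n * x powr ((real n - 1) / 2) * ln (1 / x)))"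
proof -
  have p: "0 < p" "p < 1" and n: "0 < n" using assms by auto
  \<comment> \<open>The exponent of the antiderivative of \<open>y powr ((p - 1) * n)\<close>; its
    sign separates the three regimes.\<close>
  define b where "b = (p - 1) * real n + 1"
  have b_eq: "b = real n * p - (real n - 1)" by (simp add: b_def algebra_simps)
  have d_pos: "0 < delta p n" using assms by (simp add: delta_def)
  have Gam: "0 < Gamma (1 + delta p n) * sqrt (pi / real n)"
    using d_pos n by (intro mult_pos_pos Gamma_real_pos) auto
  have K: "0 < (p * sqrt pi) ^ n" using p by simp
  show ?thesis
  proof (intro conjI impI)
    assume ne: "real n * p \<noteq> real n - 1"
    \<comment> \<open>Off the critical line the two regimes differ only in the numerator
      \<open>D\<close> of the constant and in the growth of the moment; the \<open>/ 1\<close> is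
      the trivial slowly varying factor.\<close>
    obtain D where D: "0 < D" "Cpn p n = D / (Gamma (1 + delta p n) * sqrt (pi / real n))"
      and lim: "((\<lambda>T. T powr (2 * delta p n - real n * p) * trunc_h_moment p n T / 1) \<longlongrightarrow> D) at_top"
    proof (cases "real n * p < real n - 1")
      case True
      then have sub: "(p - 1) * real n < - 1" by (simp add: algebra_simps)
      show ?thesis
      proof (rule that)
        show "0 < (\<integral>y. hminus p y ^ n \<partial>lborel)" by (rule hminus_power_integral_pos[OF p n sub])
        show "Cpn p n = (\<integral>y. hminus p y ^ n \<partial>lborel) / (Gamma (1 + delta p n) * sqrt (pi / real n))"
          using True by (simp add: Cpn_def hminus_hplus_power_integral[OF p n sub])
        \<comment> \<open>No power of \<open>T\<close> survives here. The identity holds only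
          eventually because \<open>0 powr 0\<close> is 0.\<close>
        have "2 * delta p n - real n * p = 0" using True by (simp add: delta_def)
        then have "\<forall>\<^sub>F T in at_top. trunc_h_moment p n T = T powr (2 * delta p n - real n * p) * trunc_h_moment p n T / 1"
          by (intro eventually_mono[OF eventually_gt_at_top[of 0]]) simp
        with trunc_h_moment_tendsto[OF p n sub]
        show "((\<lambda>T. T powr (2 * delta p n - real n * p) * trunc_h_moment p n T / 1) \<longlongrightarrow> (\<integral>y. hminus p y ^ n \<partial>lborel)) at_top"
          by (rule Lim_transform_eventually)
      qed
    next
      case False
      with ne have gt: "real n * p > real n - 1" by simp
      then have b: "0 < b" by (simp add: b_eq)
      show ?thesis
      proof (rule that)
        show "0 < (p * sqrt pi) ^ n / b" using K b by simp
        show "Cpn p n = (p * sqrt pi) ^ n / b / (Gamma (1 + delta p n) * sqrt (pi / real n))"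
          using gt by (simp add: Cpn_def b_def)
        \<comment> \<open>Now \<open>2 * delta p n = n - 1\<close>, so the weight is
          \<open>T powr (- b)\<close>. It cancels the growth \<open>T powr b / b\<close> up to the
          \<open>1 / b\<close> that enters the constant.\<close>
        have "((\<lambda>T. trunc_h_moment p n T / (T powr b / b)) \<longlongrightarrow> (p * sqrt pi) ^ n) at_top"
        proof (rule trunc_h_moment_asymp[OF p n])
          show "((\<lambda>T. T powr b / b) has_real_derivative y powr ((p - 1) * real n)) (at y)" if "0 < y" for y
            using powr_antideriv[of "(p - 1) * real n" y] that b by (simp add: b_def)
          show "filterlim (\<lambda>T. T powr b / b) at_top at_top"
            using b by real_asymp
        qed
        then have "((\<lambda>T. trunc_h_moment p n T / (T powr b / b) / b) \<longlongrightarrow> (p * sqrt pi) ^ n / b) at_top"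
          using b by (intro tendsto_divide tendsto_const) auto
        moreover have "\<forall>\<^sub>F T in at_top. trunc_h_moment p n T / (T powr b / b) / b
            = T powr (2 * delta p n - real n * p) * trunc_h_moment p n T / 1"
          using eventually_gt_at_top[of "0::real"]
        proof eventually_elim
          case (elim T)
          have exponent: "2 * delta p n - real n * p = - b" using gt by (simp add: delta_def b_eq)
          show ?case unfolding exponent using b by (simp add: powr_minus_divide)
        qed
        ultimately show "((\<lambda>T. T powr (2 * delta p n - real n * p) * trunc_h_moment p n T / 1) \<longlongrightarrow> (p * sqrt pi) ^ n / b) at_top"
          by (rule Lim_transform_eventually)
      qed
    qed
    have "((\<lambda>x. FQ p n x / (x powr delta p n * 1)) \<longlongrightarrow> Cpn p n) (at_right 0)"
      unfolding D(2) using d_pos D(1) lim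
      by (intro FQ_tendsto[OF p n, where L = "\<lambda>_. 1"]) auto
    then show "FQ p n \<sim>[at_right 0] (\<lambda>x. Cpn p n * x powr delta p n)"
      using D Gam n by (intro asymp_equivI'_const) auto
  next
    assume eq: "real n * p = real n - 1"
    then have d: "delta p n = (real n - 1) / 2" by (simp add: delta_def)
    have C: "Cpn p n = (p * sqrt pi) ^ n / 2 / (Gamma (1 + delta p n) * sqrt (pi / real n))"
      using eq by (simp add: Cpn_def)
    \<comment> \<open>The exponent \<open>(p - 1) * n\<close> is exactly -1, so the antiderivative
      is the logarithm.\<close>
    have Jl: "((\<lambda>T. trunc_h_moment p n T / ln T) \<longlongrightarrow> (p * sqrt pi) ^ n) at_top"
    proof (rule trunc_h_moment_asymp[OF p n _ ln_at_top])
      have "(p - 1) * real n = - 1" using eq by (simp add: algebra_simps)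
      then show "(ln has_real_derivative y powr ((p - 1) * real n)) (at y)" if "0 < y" for y :: real
        using that by (auto intro!: derivative_eq_intros simp: powr_minus_divide)
    qed
    have "((\<lambda>x. FQ p n x / (x powr delta p n * ln (1 / x))) \<longlongrightarrow> Cpn p n) (at_right 0)"
      unfolding C
    proof (rule FQ_tendsto[OF p n d_pos])
      show "0 \<le> (p * sqrt pi) ^ n / 2" using K by simp
      show "\<forall>\<^sub>F t in at_top. 0 < ln (t::real)"
        using eventually_gt_at_top[of 1] by eventually_elim simp
      show "((\<lambda>t. ln (real (Suc k) * t) / ln t) \<longlongrightarrow> 1) at_top" for k
      proof -
        have "((\<lambda>t. ln (c * t) / ln t) \<longlongrightarrow> 1) at_top" if "0 < c" for c :: real
          using that by real_asymp
        then show ?thesis by (metis of_nat_0_less_iff zero_less_Suc)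
      qed
      \<comment> \<open>The Laplace variable is \<open>T^2\<close> and
        \<open>ln (T^2) = 2 * ln T\<close>; this is the origin of the factor 1/2 in the critical
        constant.\<close>
      have "((\<lambda>T. trunc_h_moment p n T / ln T / 2) \<longlongrightarrow> (p * sqrt pi) ^ n / 2) at_top"
        by (intro tendsto_divide Jl tendsto_const) auto
      moreover have "\<forall>\<^sub>F T in at_top. trunc_h_moment p n T / ln T / 2
          = T powr (2 * delta p n - real n * p) * trunc_h_moment p n T / ln (T\<^sup>2)"
        using eventually_gt_at_top[of 0]
      proof eventually_elim
        case (elim T)
        have exponent: "2 * delta p n - real n * p = 0" using eq d by simp
        show ?case unfolding exponent using elim by (simp add: ln_realpow)
      qed
      ultimately show "((\<lambda>T. T powr (2 * delta p n - real n * p) * trunc_h_moment p n T / ln (T\<^sup>2)) \<longlongrightarrow> (p * sqrt pi) ^ n / 2) at_top"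
        by (rule Lim_transform_eventually)
    qed
    then have "FQ p n \<sim>[at_right 0] (\<lambda>x. Cpn p n * (x powr delta p n * ln (1 / x)))"
      using C Gam p n by (intro asymp_equivI'_const) auto
    then show "FQ p n \<sim>[at_right 0] (\<lambda>x. Cpn p n * x powr ((real n - 1) / 2) * ln (1 / x))"
      by (simp only: d mult.assoc)
  qed
qed

end
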